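(* Let $f(q)=q+\sum_{k=2}^{\infty}q^kp_k\in\mathcal{S}^*$ (with $p_k\in\mathbb{H}$) be a slice starlike function on $\mathbb{B}$. Then $$|q|+\sum_{k=2}^{\infty}|q^kp_k|\leq 1\quad\text{for all } q\in\mathbb{B}\text{ with } |q|\leq \frac{3-\sqrt{5}}{2}.$$ The constant $(3-\sqrt{5})/2$ cannot be improved, i.e. it cannot be replaced by any larger number so that the inequality remains true for all $f\in\mathcal{S}^*$.
   Context: $\mathbb{H}$ is the skew field of quaternions with its usual modulus $|\cdot|$ and real part $\mathrm{Re}$; $\mathbb{B}=\{q\in\mathbb{H}:|q|<1\}$. Let $\mathbb{S}=\{q\in\mathbb{H}:q^2=-1\}$ and, for $I\in\mathbb{S}$, $\mathbb{C}_I=\mathbb{R}\oplus I\mathbb{R}$ and $\mathbb{B}_I=\mathbb{B}\cap\mathbb{C}_I$. A function $f:\mathbb{B}\to\mathbb{H}$ is (left) slice regular if for every $I\in\mathbb{S}$ its restriction $f_I$ to $\mathbb{B}_I$ has continuous partial derivatives and satisfies $\frac12\left(\frac{\partial}{\partial x}+I\frac{\partial}{\partial y}\right)f_I(x+yI)=0$ for all $x+yI\in\mathbb{B}_I$. Every slice regular $f$ on $\mathbb{B}$ has a power series expansion $f(q)=\sum_{k=0}^\infty q^kp_k$ on $\mathbb{B}$ with $p_k\in\mathbb{H}$. The slice derivative $f'$ is defined on each $\mathbb{B}_I$ by $f'(x+yI)=\frac12\left(\frac{\partial}{\partial x}-I\frac{\partial}{\partial y}\right)f_I(x+yI)$. $\mathcal{S}$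 denotes the class of slice regular functions $f$ on $\mathbb{B}$ with $f(0)=0$, $f'(0)=1$, and whose zero set in $\mathbb{B}$ is exactly $\{0\}$. The class of slice starlike functions is $$\mathcal{S}^*=\{f\in\mathcal{S}:\ \mathrm{Re}\left(f(q)^{-1}qf'(q)\right)>0\ \text{on}\ \mathbb{B}\},$$ where at $q=0$ the expression $f(q)^{-1}qf'(q)$ is understood as its limit, $1$. *)

theory Defs
  imports "HOL-Analysis.Analysis"
begin

section \<open>Quaternions\<close>

datatype quat = Quat (qRe: real) (qIm1: real) (qIm2: real) (qIm3: real)

lemma quat_eqI:
  "qRe p = qRe q \<Longrightarrow> qIm1 p = qIm1 q \<Longrightarrow> qIm2 p = qIm2 q \<Longrightarrow> qIm3 p = qIm3 q \<Longrightarrow> p = q"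
  by (rule quat.expand) simp

lemma quat_eq_iff:
  "p = q \<longleftrightarrow> qRe p = qRe q \<and> qIm1 p = qIm1 q \<and> qIm2 p = qIm2 q \<and> qIm3 p = qIm3 q"
  using quat_eqI by blast

instantiation quat :: real_vector
begin

definition "0 = Quat 0 0 0 0"
definition "p + q = Quat (qRe p + qRe q) (qIm1 p + qIm1 q) (qIm2 p + qIm2 q) (qIm3 p + qIm3 q)"
definition "p - q = Quat (qRe p - qRe q) (qIm1 p - qIm1 q) (qIm2 p - qIm2 q) (qIm3 p - qIm3 q)"
definition "- p = Quat (- qRe p) (- qIm1 p) (- qIm2 p) (- qIm3 p)"
definition "r *\<^sub>R p = Quat (r * qRe p) (r * qIm1 p) (r * qIm2 p) (r * qIm3 p)"

instance
  by standard
    (auto simp: zero_quat_def plus_quat_def minus_quat_def uminus_quat_def scaleR_quat_def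
      algebra_simps)

end

lemma quat_sel_simps [simp]:
  "qRe 0 = 0" "qIm1 0 = 0" "qIm2 0 = 0" "qIm3 0 = 0"
  "qRe (p + q) = qRe p + qRe q" "qIm1 (p + q) = qIm1 p + qIm1 q"
  "qIm2 (p + q) = qIm2 p + qIm2 q" "qIm3 (p + q) = qIm3 p + qIm3 q"
  "qRe (p - q) = qRe p - qRe q" "qIm1 (p - q) = qIm1 p - qIm1 q"
  "qIm2 (p - q) = qIm2 p - qIm2 q" "qIm3 (p - q) = qIm3 p - qIm3 q"
  "qRe (- p) = - qRe p" "qIm1 (- p) = - qIm1 p" "qIm2 (- p) = - qIm2 p" "qIm3 (- p) = - qIm3 p"
  "qRe (r *\<^sub>R p) = r * qRe p" "qIm1 (r *\<^sub>R p) = r * qIm1 p"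
  "qIm2 (r *\<^sub>R p) = r * qIm2 p" "qIm3 (r *\<^sub>R p) = r * qIm3 p"
  by (simp_all add: zero_quat_def plus_quat_def minus_quat_def uminus_quat_def scaleR_quat_def)

instantiation quat :: real_algebra_1
begin

definition "1 = Quat 1 0 0 0"
definition "p * q = Quat
  (qRe p * qRe q - qIm1 p * qIm1 q - qIm2 p * qIm2 q - qIm3 p * qIm3 q)
  (qRe p * qIm1 q + qIm1 p * qRe q + qIm2 p * qIm3 q - qIm3 p * qIm2 q)
  (qRe p * qIm2 q - qIm1 p * qIm3 q + qIm2 p * qRe q + qIm3 p * qIm1 q)
  (qRe p * qIm3 q + qIm1 p * qIm2 q - qIm2 p * qIm1 q + qIm3 p * qRe q)"

instance
  by standard (auto simp: quat_eq_iff one_quat_def times_quat_def algebra_simps)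

end

lemma quat_one_simps [simp]: "qRe 1 = 1" "qIm1 1 = 0" "qIm2 1 = 0" "qIm3 1 = 0"
  by (simp_all add: one_quat_def)

lemma quat_mult_simps [simp]:
  "qRe (p * q) = qRe p * qRe q - qIm1 p * qIm1 q - qIm2 p * qIm2 q - qIm3 p * qIm3 q"
  "qIm1 (p * q) = qRe p * qIm1 q + qIm1 p * qRe q + qIm2 p * qIm3 q - qIm3 p * qIm2 q"
  "qIm2 (p * q) = qRe p * qIm2 q - qIm1 p * qIm3 q + qIm2 p * qRe q + qIm3 p * qIm1 q"
  "qIm3 (p * q) = qRe p * qIm3 q + qIm1 p * qIm2 q - qIm2 p * qIm1 q + qIm3 p * qRe q"
  by (simp_all add: times_quat_def)

lemma quat_of_real_simps [simp]:
  "qRe (of_real r) = r" "qIm1 (of_real r) = 0" "qIm2 (of_real r) = 0" "qIm3 (of_real r) = 0"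
  by (simp_all add: of_real_def)

lemma quat_sum_squares_eq_0:
  "(qRe p)\<^sup>2 + (qIm1 p)\<^sup>2 + (qIm2 p)\<^sup>2 + (qIm3 p)\<^sup>2 = 0 \<longleftrightarrow> p = 0"
  by (auto simp: quat_eq_iff add_nonneg_eq_0_iff)

instantiation quat :: real_inner
begin

definition "inner p q = qRe p * qRe q + qIm1 p * qIm1 q + qIm2 p * qIm2 q + qIm3 p * qIm3 q"
definition "norm p = sqrt ((qRe p)\<^sup>2 + (qIm1 p)\<^sup>2 + (qIm2 p)\<^sup>2 + (qIm3 p)\<^sup>2)"
definition "sgn p = p /\<^sub>R norm (p :: quat)"
definition "dist p q = norm (p - q :: quat)"
definition "(uniformity :: (quat \<times> quat) filter) = (INF e\<in>{0 <..}. principal {(x, y). dist x y < e})"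
definition "open (U :: quat set) \<longleftrightarrow> (\<forall>x\<in>U. eventually (\<lambda>(x', y). x' = x \<longrightarrow> y \<in> U) uniformity)"

instance
proof
  fix p :: quat
  show "inner p p = 0 \<longleftrightarrow> p = 0"
    using quat_sum_squares_eq_0[of p] by (simp add: inner_quat_def power2_eq_square)
qed (auto simp: inner_quat_def norm_quat_def sgn_quat_def dist_quat_def uniformity_quat_def
      open_quat_def algebra_simps power2_eq_square)

end

instantiation quat :: real_normed_div_algebra
begin

text \<open>The conjugate divided by the squared modulus.\<close>
definition "inverse p =
  (1 / (norm p)\<^sup>2) *\<^sub>R Quat (qRe p) (- qIm1 p) (- qIm2 p) (- qIm3 p)"
definition "p div q = p * inverse (q :: quat)"

instance
proof
  fix p q :: quat
  have n: "(norm r)\<^sup>2 = (qRe r)\<^sup>2 + (qIm1 r)\<^sup>2 + (qIm2 r)\<^sup>2 + (qIm3 r)\<^sup>2" for r :: quat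
    by (simp add: norm_quat_def)
  show "p div q = p * inverse q"
    by (rule divide_quat_def)
  show "inverse (0 :: quat) = 0"
    by (simp add: inverse_quat_def)
  show "norm (p * q) = norm p * norm q"
    unfolding norm_quat_def real_sqrt_mult[symmetric] quat_mult_simps
    by (rule arg_cong[of _ _ sqrt]) (simp add: power2_eq_square algebra_simps)
  assume "p \<noteq> 0"
  then have nz: "(norm p)\<^sup>2 \<noteq> 0"
    by simp
  let ?c = "Quat (qRe p) (- qIm1 p) (- qIm2 p) (- qIm3 p)"
  have c: "?c * p = (norm p)\<^sup>2 *\<^sub>R 1" "p * ?c = (norm p)\<^sup>2 *\<^sub>R 1"
    unfolding n by (auto simp: quat_eq_iff power2_eq_square algebra_simps)
  show "inverse p * p = 1" "p * inverse p = 1"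
    using nz c by (simp_all add: inverse_quat_def)
qed

end

instantiation quat :: euclidean_space
begin

definition "Basis = {Quat 1 0 0 0, Quat 0 1 0 0, Quat 0 0 1 0, Quat 0 0 0 1}"

instance
proof
  show "(Basis :: quat set) \<noteq> {}" "finite (Basis :: quat set)"
    by (simp_all add: Basis_quat_def)
  show "inner u v = (if u = v then 1 else 0)" if "u \<in> Basis" "v \<in> Basis" for u v :: quat
    using that unfolding Basis_quat_def
    by (elim insertE emptyE) (simp_all add: inner_quat_def)
  show "(\<forall>u\<in>Basis. inner p u = 0) \<longleftrightarrow> p = 0" for p :: quat
    unfolding Basis_quat_def by (simp add: inner_quat_def) (simp add: quat_eq_iff)
qed

end

section \<open>Slice regular functions on the unit ball\<close>

abbreviation quat_ball :: "quat set" where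
  "quat_ball \<equiv> ball 0 1"

definition quat_units :: "quat set" where
  "quat_units = {q. q\<^sup>2 = - 1}"

text \<open>The point \<open>x + yI\<close> of the slice \<open>\<complex>\<^sub>I\<close>.\<close>
definition slice_point :: "quat \<Rightarrow> real \<Rightarrow> real \<Rightarrow> quat" where
  "slice_point I x y = of_real x + of_real y * I"

text \<open>The ball \<open>\<bbbB>\<^sub>I\<close>, in the real coordinates \<open>(x, y)\<close> of \<open>\<complex>\<^sub>I\<close>.\<close>
definition slice_ball :: "quat \<Rightarrow> (real \<times> real) set" where
  "slice_ball I = {(x, y). slice_point I x y \<in> quat_ball}"

definition slice_dx :: "quat \<Rightarrow> (quat \<Rightarrow> quat) \<Rightarrow> real \<Rightarrow> real \<Rightarrow> quat" where
  "slice_dx I f x y = vector_derivative (\<lambda>t. f (slice_point I t y)) (at x)"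

definition slice_dy :: "quat \<Rightarrow> (quat \<Rightarrow> quat) \<Rightarrow> real \<Rightarrow> real \<Rightarrow> quat" where
  "slice_dy I f x y = vector_derivative (\<lambda>t. f (slice_point I x t)) (at y)"

text \<open>Only the values of \<open>f\<close> on the unit ball are relevant below.\<close>
definition slice_regular :: "(quat \<Rightarrow> quat) \<Rightarrow> bool" where
  "slice_regular f \<longleftrightarrow> (\<forall>I\<in>quat_units.
     (\<forall>(x, y)\<in>slice_ball I.
        (\<lambda>t. f (slice_point I t y)) differentiable (at x) \<and>
        (\<lambda>t. f (slice_point I x t)) differentiable (at y)) \<and>
     continuous_on (slice_ball I) (\<lambda>(x, y). slice_dx I f x y) \<and>
     continuous_on (slice_ball I) (\<lambda>(x, y). slice_dy I f x y) \<and>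
     (\<forall>(x, y)\<in>slice_ball I. (1/2) *\<^sub>R (slice_dx I f x y + I * slice_dy I f x y) = 0))"

text \<open>
  The slice derivative is prescribed on each slice. A point lies on several slices (or has
  several representations \<open>x + yI\<close>), but for slice regular \<open>f\<close> these all give
  the same value; see \<open>slice_deriv_slice_point\<close>.
\<close>
definition slice_deriv :: "(quat \<Rightarrow> quat) \<Rightarrow> quat \<Rightarrow> quat" where
  "slice_deriv f q = (THE d. \<forall>I\<in>quat_units. \<forall>x y. q = slice_point I x y \<longrightarrow>
     d = (1/2) *\<^sub>R (slice_dx I f x y - I * slice_dy I f x y))"

lemma quat_units_sq: "I \<in> quat_units \<Longrightarrow> I * I = - 1"
  by (simp add: quat_units_def power2_eq_square)

lemma quat_units_components:
  assumes "I \<in> quat_units"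
  shows "qRe I = 0" "(qIm1 I)\<^sup>2 + (qIm2 I)\<^sup>2 + (qIm3 I)\<^sup>2 = 1"
proof -
  have e: "qRe I * qRe I - qIm1 I * qIm1 I - qIm2 I * qIm2 I - qIm3 I * qIm3 I = - 1"
    "qRe I * qIm1 I = 0" "qRe I * qIm2 I = 0" "qRe I * qIm3 I = 0"
    using quat_units_sq[OF assms] by (auto simp: quat_eq_iff algebra_simps)
  show r: "qRe I = 0"
  proof (rule ccontr)
    assume "qRe I \<noteq> 0"
    with e have "qRe I * qRe I = - 1"
      by simp
    then show False
      using zero_le_square[of "qRe I"] by linarith
  qed
  show "(qIm1 I)\<^sup>2 + (qIm2 I)\<^sup>2 + (qIm3 I)\<^sup>2 = 1"
    using e(1) r by (simp add: power2_eq_square)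
qed

lemma slice_point_eqD:
  assumes I: "I \<in> quat_units" and J: "J \<in> quat_units"
    and eq: "slice_point I x y = slice_point J u v"
  shows "u = x \<and> (y = 0 \<and> v = 0 \<or> J = I \<and> v = y \<or> J = - I \<and> v = - y)"
proof -
  note i = quat_units_components[OF I] and j = quat_units_components[OF J]
  have x: "x = u" and c: "y * qIm1 I = v * qIm1 J" "y * qIm2 I = v * qIm2 J"
      "y * qIm3 I = v * qIm3 J"
    using eq i(1) j(1) by (auto simp: slice_point_def quat_eq_iff)
  have "y\<^sup>2 * ((qIm1 I)\<^sup>2 + (qIm2 I)\<^sup>2 + (qIm3 I)\<^sup>2) = v\<^sup>2 * ((qIm1 J)\<^sup>2 + (qIm2 J)\<^sup>2 + (qIm3 J)\<^sup>2)"
    unfolding distrib_left power_mult_distrib[symmetric] c by simp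
  then have "v = y \<or> v = - y"
    using i(2) j(2) by (auto simp: power2_eq_iff)
  moreover have "y *\<^sub>R I = v *\<^sub>R J"
    using c i(1) j(1) by (simp add: quat_eq_iff)
  moreover have "J = - I" if "y *\<^sub>R I = (- y) *\<^sub>R J" "y \<noteq> 0"
  proof -
    have "y *\<^sub>R I = y *\<^sub>R (- J)"
      using that(1) by simp
    then show ?thesis
      using that(2) by (simp only: scaleR_cancel_left) simp
  qed
  ultimately show ?thesis
    using x by (cases "y = 0") auto
qed

lemma slice_dy_uminus:
  assumes "(\<lambda>t. f (slice_point I x t)) differentiable (at y)"
  shows "slice_dy (- I) f x (- y) = - slice_dy I f x y"
proof -
  let ?g = "\<lambda>t. f (slice_point I x t)"
  have "(?g has_vector_derivative slice_dy I f x y) (at (- (- y)))"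
    using assms by (simp add: slice_dy_def vector_derivative_works)
  moreover have "(uminus has_vector_derivative (- 1 :: real)) (at (- y))"
    by (auto intro!: derivative_eq_intros)
  ultimately have "((?g \<circ> uminus) has_vector_derivative (- 1) *\<^sub>R slice_dy I f x y) (at (- y))"
    by (intro vector_diff_chain_at) simp_all
  moreover have "?g \<circ> uminus = (\<lambda>t. f (slice_point (- I) x t))"
    by (simp add: fun_eq_iff slice_point_def)
  ultimately show ?thesis
    unfolding slice_dy_def by (simp add: vector_derivative_at)
qed

lemma slice_deriv_slice_point:
  assumes f: "slice_regular f" and I: "I \<in> quat_units" and B: "slice_point I x y \<in> quat_ball"
  shows "slice_deriv f (slice_point I x y) = (1/2) *\<^sub>R (slice_dx I f x y - I * slice_dy I f x y)"
proof -
  let ?D = "\<lambda>I x y. (1/2) *\<^sub>R (slice_dx I f x y - I * slice_dy I f x y)"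
  have B': "(x, y) \<in> slice_ball I"
    using B by (simp add: slice_ball_def)
  have diff: "(\<lambda>t. f (slice_point I x t)) differentiable (at y)"
    using f I B' unfolding slice_regular_def by fast
  have "?D J u v = ?D I x y"
    if J: "J \<in> quat_units" and eq: "slice_point I x y = slice_point J u v" for J u v
  proof -
    have D: "?D K s t = slice_dx K f s t"
      if "K \<in> quat_units" "slice_point K s t \<in> quat_ball" for K s t
    proof -
      have "(s, t) \<in> slice_ball K"
        using that by (simp add: slice_ball_def)
      then have "(1/2) *\<^sub>R (slice_dx K f s t + K * slice_dy K f s t) = 0"
        using f that(1) unfolding slice_regular_def by fast
      then have "slice_dx K f s t = - (K * slice_dy K f s t)"
        by (simp add: eq_neg_iff_add_eq_0)
      then show ?thesis
        by (simp add: scaleR_2[symmetric] algebra_simps flip: scaleR_add_left)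
    qed
    from slice_point_eqD[OF I J eq] consider
      "u = x" "y = 0" "v = 0" | "u = x" "J = I" "v = y" | "u = x" "J = - I" "v = - y"
      by blast
    then show ?thesis
    proof cases
      case 1
      have "slice_dx J f u v = slice_dx I f x y"
        using 1 by (simp add: slice_dx_def slice_point_def)
      then show ?thesis
        using D[OF J, of u v] D[OF I, of x y] B eq by metis
    next
      case 2
      then show ?thesis by simp
    next
      case 3
      have "slice_dx J f u v = slice_dx I f x y"
        using 3 by (simp add: slice_dx_def slice_point_def)
      then show ?thesis
        using 3 slice_dy_uminus[OF diff] by simp
    qed
  qed
  then have *: "\<forall>J\<in>quat_units. \<forall>u v. slice_point I x y = slice_point J u v \<longrightarrow> ?D I x y = ?D J u v"
    by metis
  show ?thesis
    unfolding slice_deriv_def by (rule the_equality, rule *) (use I in metis)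
qed

section \<open>Slice starlike functions\<close>

definition slice_class_S :: "(quat \<Rightarrow> quat) set" where
  "slice_class_S = {f. slice_regular f \<and> f 0 = 0 \<and> slice_deriv f 0 = 1 \<and>
     {q \<in> quat_ball. f q = 0} = {0}}"

text \<open>At \<open>q = 0\<close> the expression \<open>f(q)\<^sup>-\<^sup>1 q f'(q)\<close> stands for its limit \<open>1\<close>.\<close>
definition starlike_quotient :: "(quat \<Rightarrow> quat) \<Rightarrow> quat \<Rightarrow> quat" where
  "starlike_quotient f q = (if q = 0 then 1 else inverse (f q) * q * slice_deriv f q)"

definition slice_starlike :: "(quat \<Rightarrow> quat) set" where
  "slice_starlike = {f \<in> slice_class_S. \<forall>q\<in>quat_ball. qRe (starlike_quotient f q) > 0}"

text \<open>
  \<open>f(q) = q + \<Sum>\<^sub>k\<^sub>\<ge>\<^sub>2 q\<^sup>k p\<^sub>k\<close> on the unit ball; the values \<open>p 0\<close> and \<open>p 1\<close> are not used.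
\<close>
definition has_normalized_expansion :: "(quat \<Rightarrow> quat) \<Rightarrow> (nat \<Rightarrow> quat) \<Rightarrow> bool" where
  "has_normalized_expansion f p \<longleftrightarrow>
     (\<forall>q\<in>quat_ball. (\<lambda>k. q ^ (k + 2) * p (k + 2)) sums (f q - q))"

end

theory Submission
  imports Defs "HOL-Complex_Analysis.Complex_Analysis"
begin

text \<open>
  As in the classical case, the bound follows from \<open>|p\<^sub>k| \<le> k\<close> and
  \<open>\<Sum> k r\<^sup>k = r / (1 - r)\<^sup>2\<close>, which is \<open>1\<close> at \<open>r = (3 - \<surd>5) / 2\<close>; the Koebe function
  \<open>q(1 - q)\<^sup>-\<^sup>2\<close> shows sharpness.

  For the coefficient bound, starlikeness means \<open>\<langle>f(q), q f'(q)\<rangle> > 0\<close>. Conjugating \<open>q\<close> into \<open>\<complex>\<close> and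
  splitting \<open>\<bbbH> = \<complex> \<oplus> \<complex>j\<close> turns this condition, over all slices at once, into positivity of the Hermitian part of
  \<open>z F'(z) F(z)\<^sup>*\<close> for a holomorphic \<open>2 \<times> 2\<close> matrix \<open>F\<close>. This matrix is congruent to
  \<open>H = F\<^sup>-\<^sup>1 z F'\<close>, so Caratheodory's inequality gives \<open>|h\<^sub>n| \<le> 2\<close> for the quaternionic coefficients of \<open>H\<close>, and
  the recursion \<open>n p\<^sub>n = \<Sum> p\<^sub>j h\<^sub>n\<^sub>-\<^sub>j\<close> yields \<open>|p\<^sub>n| \<le> n\<close> by induction.
\<close>

section \<open>Quaternions as pairs of complex numbers\<close>

text \<open>\<open>quat_pair a b\<close> is a + bj. Since jz = cnj(z) j, the conjugates in the
  product rules for \<open>quat_fst\<close> and \<open>quat_snd\<close> come from moving j past a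
  complex number.\<close>

definition quat_pair :: "complex \<Rightarrow> complex \<Rightarrow> quat" where
  "quat_pair a b = Quat (Re a) (Im a) (Re b) (Im b)"

definition quat_fst :: "quat \<Rightarrow> complex" where
  "quat_fst q = Complex (qRe q) (qIm1 q)"

definition quat_snd :: "quat \<Rightarrow> complex" where
  "quat_snd q = Complex (qIm2 q) (qIm3 q)"

abbreviation quat_of_complex :: "complex \<Rightarrow> quat" where
  "quat_of_complex z \<equiv> quat_pair z 0"

lemma quat_pair_sel [simp]:
  "qRe (quat_pair a b) = Re a" "qIm1 (quat_pair a b) = Im a"
  "qIm2 (quat_pair a b) = Re b" "qIm3 (quat_pair a b) = Im b"
  by (simp_all add: quat_pair_def)

lemma quat_fst_pair [simp]: "quat_fst (quat_pair a b) = a"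
  and quat_snd_pair [simp]: "quat_snd (quat_pair a b) = b"
  by (simp_all add: quat_fst_def quat_snd_def)

lemma quat_eq_fst_snd: "p = q \<longleftrightarrow> quat_fst p = quat_fst q \<and> quat_snd p = quat_snd q"
  by (auto simp: quat_fst_def quat_snd_def quat_eq_iff)

lemma quat_fst_simps [simp]:
  "quat_fst 0 = 0" "quat_fst 1 = 1"
  "quat_fst (p + q) = quat_fst p + quat_fst q" "quat_fst (p - q) = quat_fst p - quat_fst q"
  "quat_fst (r *\<^sub>R p) = r *\<^sub>R quat_fst p"
  "quat_fst (p * q) = quat_fst p * quat_fst q - quat_snd p * cnj (quat_snd q)"
  by (simp_all add: quat_fst_def quat_snd_def complex_eq_iff algebra_simps)

lemma quat_snd_simps [simp]:
  "quat_snd 0 = 0" "quat_snd 1 = 0"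
  "quat_snd (p + q) = quat_snd p + quat_snd q" "quat_snd (p - q) = quat_snd p - quat_snd q"
  "quat_snd (r *\<^sub>R p) = r *\<^sub>R quat_snd p"
  "quat_snd (p * q) = quat_fst p * quat_snd q + quat_snd p * cnj (quat_fst q)"
  by (simp_all add: quat_fst_def quat_snd_def complex_eq_iff algebra_simps)

lemma quat_fst_of_nat [simp]: "quat_fst (of_nat n) = of_nat n"
  and quat_snd_of_nat [simp]: "quat_snd (of_nat n) = 0"
proof -
  have "(of_nat n :: quat) = of_real (real n)"
    by (simp only: of_real_of_nat_eq)
  then show "quat_fst (of_nat n) = of_nat n" "quat_snd (of_nat n) = 0"
    by (simp_all only: quat_fst_def quat_snd_def quat_of_real_simps) (simp_all add: complex_eq_iff)
qed

lemma bounded_linear_quat_fst: "bounded_linear quat_fst"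
  and bounded_linear_quat_snd: "bounded_linear quat_snd"
  by (auto intro!: linearI simp flip: linear_conv_bounded_linear)

lemma quat_fst_sum [simp]: "quat_fst (sum f S) = (\<Sum>i\<in>S. quat_fst (f i))"
  and quat_snd_sum [simp]: "quat_snd (sum f S) = (\<Sum>i\<in>S. quat_snd (f i))"
  by (simp_all add: linear_sum bounded_linear.linear bounded_linear_quat_fst bounded_linear_quat_snd)

lemma inner_quat_fst_snd:
  "inner p q = Re (cnj (quat_fst p) * quat_fst q + cnj (quat_snd p) * quat_snd q)"
  by (simp add: inner_quat_def quat_fst_def quat_snd_def)

lemma norm_quat_of_complex [simp]: "norm (quat_of_complex z) = cmod z"
  by (simp add: norm_quat_def cmod_def)

lemma quat_of_complex_power: "quat_of_complex (z ^ k) = quat_of_complex z ^ k"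
  by (induction k) (simp_all add: quat_eq_fst_snd)

text \<open>The inverse is the conjugate over the squared norm, and Re(conj(p) q) is the inner
  product. Starlikeness thus becomes positivity of an inner product, free of division.\<close>

lemma qRe_inverse_mult: "qRe (inverse p * q) = inner p q / (norm p)\<^sup>2"
  by (simp add: inverse_quat_def inner_quat_def field_simps add_divide_distrib)

lemma inner_quat_mult_left: "inner (w * p) (w * q :: quat) = (norm w)\<^sup>2 * inner p q"
  by (simp add: inner_quat_def norm_quat_def power2_eq_square algebra_simps)

lemma inner_quat_mult_right: "inner (p * w) (q * w :: quat) = (norm w)\<^sup>2 * inner p q"
  by (simp add: inner_quat_def norm_quat_def power2_eq_square algebra_simps)

section \<open>Conjugation of quaternions into the complex plane\<close>

lemma conjugate_power:
  fixes w x :: "'a :: division_ring"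
  assumes "w \<noteq> 0"
  shows "(w * x * inverse w) ^ k = w * x ^ k * inverse w"
proof (induction k)
  case (Suc k)
  have "(w * x * inverse w) * (w * x ^ k * inverse w) = w * x * (inverse w * w) * x ^ k * inverse w"
    by (simp only: mult.assoc)
  then show ?case
    using assms Suc by (simp add: mult.assoc)
qed (use assms in simp)

text \<open>The vector part \<open>v\<close> of \<open>h\<close> is rotated onto \<open>|v|i\<close> by the half turn about \<open>v + |v|i\<close>.\<close>
lemma quat_conjugate_into_complex:
  obtains w z where "w \<noteq> 0" "h = w * quat_of_complex z * inverse w"
proof -
  define x y t s where "x = qIm1 h" "y = qIm2 h" "t = qIm3 h" "s = sqrt (x\<^sup>2 + y\<^sup>2 + t\<^sup>2)"
  have s: "s * s = x * x + y * y + t * t"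
    unfolding x_y_t_s_def(4) by (simp add: power2_eq_square flip: real_sqrt_mult)
  define w where "w = Quat 0 (x + s) y t"
  show ?thesis
  proof (cases "w = 0")
    case False
    have "h * w = w * quat_of_complex (Complex (qRe h) s)"
      using s by (simp add: w_def quat_eq_iff x_y_t_s_def(1-3)[symmetric] algebra_simps)
    then have "h = w * quat_of_complex (Complex (qRe h) s) * inverse w"
      using False by (metis mult.assoc mult.right_neutral right_inverse)
    with False show ?thesis
      by (rule that)
  next
    case True
    then have "y = 0" "t = 0"
      by (auto simp: w_def quat_eq_iff)
    then have "h = quat_of_complex (Complex (qRe h) (qIm1 h))"
      by (simp add: quat_eq_iff x_y_t_s_def)
    then show ?thesis
      by (intro that[of 1]) simp_all
  qed
qed

lemma norm_conjugate:
  fixes w x :: "'a :: real_normed_div_algebra"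
  assumes "w \<noteq> 0"
  shows "norm (w * x * inverse w) = norm x"
  using assms by (simp add: norm_mult norm_inverse)

lemma bounded_linear_quat_pair:
  "bounded_linear (\<lambda>a. quat_pair a 0)" "bounded_linear (\<lambda>b. quat_pair 0 b)"
  by (auto intro!: linearI simp: quat_eq_iff simp flip: linear_conv_bounded_linear)

lemma quat_pair_split: "quat_pair a b = quat_pair a 0 + quat_pair 0 b"
  by (simp add: quat_eq_iff)

lemma sums_quat_pair:
  assumes "f sums a" "g sums b"
  shows "(\<lambda>k. quat_pair (f k) (g k)) sums quat_pair a b"
  using sums_add[OF bounded_linear.sums[OF bounded_linear_quat_pair(1) assms(1)]
      bounded_linear.sums[OF bounded_linear_quat_pair(2) assms(2)]]
  by (simp only: quat_pair_split[symmetric])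

lemma has_vector_derivative_quat_pair:
  assumes "(f has_vector_derivative a) F" "(g has_vector_derivative b) F"
  shows "((\<lambda>t. quat_pair (f t) (g t)) has_vector_derivative quat_pair a b) F"
  using has_vector_derivative_add[OF bounded_linear.has_vector_derivative[OF bounded_linear_quat_pair(1) assms(1)]
      bounded_linear.has_vector_derivative[OF bounded_linear_quat_pair(2) assms(2)]]
  by (simp only: quat_pair_split[symmetric])

section \<open>Slices and the Koebe function\<close>

text \<open>Conjugation by w fixes the reals and sends i to a unit I, so it carries the plane of i
  onto the slice of I. With \<open>quat_conjugate_into_complex\<close> this puts every quaternion on
  some slice.\<close>

lemma slice_point_conjugate:
  assumes "w \<noteq> 0"
  shows "w * quat_of_complex z * inverse w = slice_point (w * quat_of_complex \<i> * inverse w) (Re z) (Im z)"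
proof -
  have "quat_of_complex z = of_real (Re z) + of_real (Im z) * quat_of_complex \<i>"
    by (simp add: quat_eq_iff)
  then have "w * quat_of_complex z * inverse w
      = w * of_real (Re z) * inverse w + w * of_real (Im z) * quat_of_complex \<i> * inverse w"
    by (simp add: algebra_simps)
  also have "w * of_real (Re z) * inverse w = of_real (Re z)"
    using assms by (simp add: Real_Vector_Spaces.of_real_def)
  also have "w * of_real (Im z) = of_real (Im z) * w"
    by (simp add: Real_Vector_Spaces.of_real_def)
  finally show ?thesis
    by (simp add: slice_point_def mult.assoc)
qed

lemma conjugate_unit:
  assumes "w \<noteq> 0"
  shows "w * quat_of_complex \<i> * inverse w \<in> quat_units"
proof -
  have "(quat_of_complex \<i>)\<^sup>2 = - 1"
    by (simp add: quat_eq_iff power2_eq_square)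
  then show ?thesis
    using assms by (simp add: quat_units_def conjugate_power)
qed

lemma quat_on_slice:
  obtains I z where "I \<in> quat_units" "q = slice_point I (Re z) (Im z)"
  by (metis quat_conjugate_into_complex conjugate_unit slice_point_conjugate)

text \<open>Since I * I = -1, sending x + yi to x + yI embeds the algebra of complex numbers;
  complex identities transfer through it to every slice.\<close>

lemma slice_point_mult:
  assumes "I \<in> quat_units"
  shows "slice_point I (Re z) (Im z) * slice_point I (Re w) (Im w)
    = slice_point I (Re (z * w)) (Im (z * w))"
proof -
  have I: "I * I = - 1" using assms by (rule quat_units_sq)
  have "slice_point I a b * slice_point I c d
      = (a * c) *\<^sub>R 1 + (a * d + b * c) *\<^sub>R I + (b * d) *\<^sub>R (I * I)" for a b c d
    by (simp add: slice_point_def Real_Vector_Spaces.of_real_def algebra_simps)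
  then show ?thesis
    by (simp add: I) (simp add: slice_point_def Real_Vector_Spaces.of_real_def algebra_simps)
qed

lemma norm_slice_point:
  assumes "I \<in> quat_units"
  shows "norm (slice_point I (Re z) (Im z)) = cmod z"
proof -
  note I = quat_units_components[OF assms]
  have "(Re z)\<^sup>2 + ((Im z * qIm1 I)\<^sup>2 + (Im z * qIm2 I)\<^sup>2 + (Im z * qIm3 I)\<^sup>2) = (Re z)\<^sup>2 + (Im z)\<^sup>2"
    by (simp add: power_mult_distrib I flip: distrib_left)
  then show ?thesis
    using I by (simp add: norm_quat_def slice_point_def cmod_def algebra_simps)
qed

lemma bounded_linear_slice_point: "bounded_linear (\<lambda>z. slice_point I (Re z) (Im z))"
  by (auto intro!: linearI simp: slice_point_def Real_Vector_Spaces.of_real_def algebra_simps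
        simp flip: linear_conv_bounded_linear)

lemma slice_point_inverse:
  assumes "I \<in> quat_units"
  shows "inverse (slice_point I (Re z) (Im z)) = slice_point I (Re (inverse z)) (Im (inverse z))"
proof (cases "z = 0")
  case False
  then show ?thesis
    by (intro inverse_unique) (simp only: slice_point_mult[OF assms], simp add: slice_point_def)
qed (simp add: slice_point_def)

lemma slice_point_power:
  assumes "I \<in> quat_units"
  shows "slice_point I (Re z) (Im z) ^ k = slice_point I (Re (z ^ k)) (Im (z ^ k))"
proof (induction k)
  case (Suc k)
  then show ?case
    using slice_point_mult[OF assms, of z "z ^ k"] by simp
qed (simp add: slice_point_def)

section \<open>Functions given by one and the same holomorphic function on every slice\<close>

context
  fixes f :: "quat \<Rightarrow> quat" and g :: "complex \<Rightarrow> complex"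
  assumes holo: "g holomorphic_on ball 0 1"
    and f: "\<And>I z. I \<in> quat_units \<Longrightarrow> cmod z < 1 \<Longrightarrow>
      f (slice_point I (Re z) (Im z)) = slice_point I (Re (g z)) (Im (g z))"
begin

lemma holomorphic_extension_partials:
  assumes I: "I \<in> quat_units" and z: "cmod (Complex x y) < 1"
  shows "((\<lambda>t. f (slice_point I t y)) has_vector_derivative
      slice_point I (Re (deriv g (Complex x y))) (Im (deriv g (Complex x y)))) (at x)"
    and "((\<lambda>t. f (slice_point I x t)) has_vector_derivative
      I * slice_point I (Re (deriv g (Complex x y))) (Im (deriv g (Complex x y)))) (at y)"
proof -
  let ?E = "\<lambda>z. slice_point I (Re z) (Im z)"
  \<comment> \<open>Both partial derivatives are derivatives along a curve \<gamma> with velocity d: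
    d = 1 in the x direction, d = i in the y direction.\<close>
  have *: "((\<lambda>t. f (slice_point I (Re (\<gamma> t)) (Im (\<gamma> t)))) has_vector_derivative ?E (d * deriv g (Complex x y))) (at s)"
    if \<gamma>: "(\<gamma> has_vector_derivative d) (at s)" "\<gamma> s = Complex x y" for \<gamma> d s
  proof -
    have g: "(g has_field_derivative deriv g (\<gamma> s)) (at (\<gamma> s))"
      using holo z \<gamma>(2) by (intro holomorphic_derivI[of g "ball 0 1"]) auto
    have "((g \<circ> \<gamma>) has_vector_derivative d * deriv g (\<gamma> s)) (at s)"
      by (rule field_vector_diff_chain_at[OF \<gamma>(1) g])
    then have "((\<lambda>t. ?E ((g \<circ> \<gamma>) t)) has_vector_derivative ?E (d * deriv g (\<gamma> s))) (at s)"
      by (rule bounded_linear.has_vector_derivative[OF bounded_linear_slice_point])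
    \<comment> \<open>The formula for \<open>f\<close> is known only over the unit disc, so the
      derivative is transferred locally.\<close>
    moreover have "\<forall>\<^sub>F t in nhds s. \<gamma> t \<in> ball 0 1"
    proof -
      have "isCont \<gamma> s"
        using \<gamma>(1) by (rule has_vector_derivative_continuous)
      then have "(\<gamma> \<longlongrightarrow> \<gamma> s) (nhds s)"
        by (simp add: continuous_within tendsto_at_iff_tendsto_nhds)
      then show ?thesis
        using z \<gamma>(2) by (intro topological_tendstoD) auto
    qed
    then have "\<forall>\<^sub>F t in nhds s. ?E ((g \<circ> \<gamma>) t) = f (slice_point I (Re (\<gamma> t)) (Im (\<gamma> t)))"
      by eventually_elim (use f I in simp)
    then obtain S where "open S" "s \<in> S"
      "\<And>t. t \<in> S \<Longrightarrow> ?E ((g \<circ> \<gamma>) t) = f (slice_point I (Re (\<gamma> t)) (Im (\<gamma> t)))"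
      by (auto simp: eventually_nhds)
    ultimately show ?thesis
      using has_vector_derivative_transform_within_open \<gamma>(2) by force
  qed
  have "((\<lambda>t. Complex t y) has_vector_derivative 1) (at x)"
    unfolding Complex_eq by (auto intro!: derivative_eq_intros)
  from *[OF this] show "((\<lambda>t. f (slice_point I t y)) has_vector_derivative ?E (deriv g (Complex x y))) (at x)"
    by simp
  have "((\<lambda>t. Complex x t) has_vector_derivative \<i>) (at y)"
    unfolding Complex_eq by (auto intro!: derivative_eq_intros)
  from *[OF this] have "((\<lambda>t. f (slice_point I x t)) has_vector_derivative ?E (\<i> * deriv g (Complex x y))) (at y)"
    by simp
  also have "?E (\<i> * deriv g (Complex x y)) = I * ?E (deriv g (Complex x y))"
    using slice_point_mult[OF I, of \<i> "deriv g (Complex x y)"] by (simp add: slice_point_def)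
  finally show "((\<lambda>t. f (slice_point I x t)) has_vector_derivative I * ?E (deriv g (Complex x y))) (at y)" .
qed

lemma slice_ball_iff:
  "I \<in> quat_units \<Longrightarrow> (x, y) \<in> slice_ball I \<longleftrightarrow> cmod (Complex x y) < 1"
  using norm_slice_point[of I "Complex x y"] by (simp add: slice_ball_def)

lemma holomorphic_extension_slice_regular: "slice_regular f"
  unfolding slice_regular_def
proof (intro ballI conjI)
  fix I assume I: "I \<in> quat_units"
  let ?D = "\<lambda>x y. slice_point I (Re (deriv g (Complex x y))) (Im (deriv g (Complex x y)))"
  have dx: "slice_dx I f x y = ?D x y" and dy: "slice_dy I f x y = I * ?D x y"
    if "(x, y) \<in> slice_ball I" for x y
    using holomorphic_extension_partials[OF I, of x y] that I
    by (auto simp: slice_dx_def slice_dy_def slice_ball_iff vector_derivative_at)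
  have cont: "continuous_on (slice_ball I) (\<lambda>(x, y). ?D x y)"
  proof -
    have "continuous_on (ball 0 1) (deriv g)"
      using holo by (intro holomorphic_on_imp_continuous_on holomorphic_deriv) auto
    moreover have "continuous_on (slice_ball I) (\<lambda>p. Complex (fst p) (snd p))"
      unfolding Complex_eq by (intro continuous_intros)
    moreover have "(\<lambda>p. Complex (fst p) (snd p)) ` slice_ball I \<subseteq> ball 0 1"
      using I by (auto simp: slice_ball_iff)
    ultimately have "continuous_on (slice_ball I) (\<lambda>p. deriv g (Complex (fst p) (snd p)))"
      using continuous_on_compose2 by blast
    then show ?thesis
      by (simp add: case_prod_unfold bounded_linear.continuous_on[OF bounded_linear_slice_point])
  qed
  show "continuous_on (slice_ball I) (\<lambda>(x, y). slice_dx I f x y)"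
    by (rule continuous_on_eq[OF cont]) (use dx in auto)
  have "continuous_on (slice_ball I) (\<lambda>p. I * (case p of (x, y) \<Rightarrow> ?D x y))"
    by (intro continuous_intros cont)
  then show "continuous_on (slice_ball I) (\<lambda>(x, y). slice_dy I f x y)"
    by (rule continuous_on_eq) (use dy in auto)
  fix p assume p: "p \<in> slice_ball I"
  obtain x y where xy: "p = (x, y)" by fastforce
  show "case p of (x, y) \<Rightarrow> (\<lambda>t. f (slice_point I t y)) differentiable (at x) \<and>
        (\<lambda>t. f (slice_point I x t)) differentiable (at y)"
    using holomorphic_extension_partials[OF I, of x y] p I
    by (auto simp: xy slice_ball_iff intro: differentiableI_vector)
  \<comment> \<open>Cauchy-Riemann equation: the y-derivative is I * D, and a further factor I turns
    it into -D, which cancels the x-derivative.\<close>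
  have "I * (I * ?D x y) = - ?D x y"
    by (simp add: quat_units_sq[OF I] flip: mult.assoc)
  then show "case p of (x, y) \<Rightarrow> (1/2) *\<^sub>R (slice_dx I f x y + I * slice_dy I f x y) = 0"
    using p by (simp add: xy dx dy)
qed

lemma holomorphic_extension_slice_deriv:
  assumes I: "I \<in> quat_units" and z: "cmod z < 1"
  shows "slice_deriv f (slice_point I (Re z) (Im z)) = slice_point I (Re (deriv g z)) (Im (deriv g z))"
proof -
  let ?D = "slice_point I (Re (deriv g z)) (Im (deriv g z))"
  have "slice_dx I f (Re z) (Im z) = ?D" "slice_dy I f (Re z) (Im z) = I * ?D"
    using holomorphic_extension_partials[OF I, of "Re z" "Im z"] z
    by (auto simp: slice_dx_def slice_dy_def vector_derivative_at)
  moreover have "I * (I * ?D) = - ?D"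
    by (simp add: quat_units_sq[OF I] flip: mult.assoc)
  moreover have "(1/2) *\<^sub>R (?D + ?D) = ?D"
    by (simp flip: scaleR_2)
  ultimately show ?thesis
    using slice_deriv_slice_point[OF holomorphic_extension_slice_regular I, of "Re z" "Im z"] z
    by (simp add: norm_slice_point[OF I])
qed

end

section \<open>The Koebe function and sharpness\<close>

lemma sums_geometric_deriv_from_2:
  fixes z :: "'a :: {real_normed_field, banach}"
  assumes "norm z < 1"
  shows "(\<lambda>k. of_nat (k + 2) * z ^ (k + 2)) sums (z / (1 - z)\<^sup>2 - z)"
proof -
  have "(\<lambda>n. of_nat (Suc n) * z ^ Suc n) sums (z / (1 - z)\<^sup>2)"
    using sums_mult[OF geometric_deriv_sums[OF assms], of z] by (simp add: mult_ac)
  then have "(\<lambda>n. of_nat (Suc (Suc n)) * z ^ Suc (Suc n)) sums (z / (1 - z)\<^sup>2 - of_nat (Suc 0) * z ^ Suc 0)"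
    by (subst sums_Suc_iff) simp
  then show ?thesis
    by simp
qed

definition koebe :: "quat \<Rightarrow> quat" where
  "koebe q = q * inverse ((1 - q)\<^sup>2)"

lemma koebe_slice_point:
  assumes I: "I \<in> quat_units"
  shows "koebe (slice_point I (Re z) (Im z)) = slice_point I (Re (z / (1 - z)\<^sup>2)) (Im (z / (1 - z)\<^sup>2))"
proof -
  have "1 - slice_point I (Re z) (Im z) = slice_point I (Re (1 - z)) (Im (1 - z))"
    by (simp add: slice_point_def)
  then show ?thesis
    by (simp only: koebe_def slice_point_power[OF I] slice_point_inverse[OF I] slice_point_mult[OF I] divide_inverse)
qed

lemma koebe_has_field_derivative:
  assumes "cmod z < 1"
  shows "((\<lambda>z. z / (1 - z)\<^sup>2) has_field_derivative (1 + z) / (1 - z) ^ 3) (at z)"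
proof -
  have "1 - z \<noteq> 0"
    using assms by auto
  moreover have "(1 - z) * (1 - z) - z * (2 * z - 2) = (1 - z) * (1 + z)"
    by (simp add: algebra_simps)
  ultimately show ?thesis
    by (auto intro!: derivative_eq_intros simp: power2_eq_square power3_eq_cube)
qed

text \<open>On each slice the quotient is the image of (1 + z)/(1 - z), whose real part (1 -
  |z|^2)/|1 - z|^2 is positive. Units have no real part, so \<open>qRe\<close> reads off exactly
  this.\<close>

lemma koebe_slice_starlike: "koebe \<in> slice_starlike"
proof -
  let ?g = "\<lambda>z::complex. z / (1 - z)\<^sup>2"
  have holo: "?g holomorphic_on ball 0 1"
    by (intro holomorphic_intros) auto
  have reg: "slice_regular koebe"
    by (rule holomorphic_extension_slice_regular[OF holo]) (rule koebe_slice_point)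
  have deriv: "slice_deriv koebe (slice_point I (Re z) (Im z))
      = slice_point I (Re ((1 + z) / (1 - z) ^ 3)) (Im ((1 + z) / (1 - z) ^ 3))"
    if "I \<in> quat_units" "cmod z < 1" for I z
    using holomorphic_extension_slice_deriv[OF holo koebe_slice_point that]
      DERIV_imp_deriv[OF koebe_has_field_derivative[OF that(2)]] by simp
  have quotient: "qRe (starlike_quotient koebe q) > 0" if "norm q < 1" for q
  proof (cases "q = 0")
    case False
    obtain I z where I: "I \<in> quat_units" and q: "q = slice_point I (Re z) (Im z)"
      by (rule quat_on_slice)
    have z: "cmod z < 1"
      using that norm_slice_point[OF I, of z] by (simp add: q)
    have z0: "z \<noteq> 0" "1 - z \<noteq> 0"
      using False z by (auto simp: q slice_point_def)
    let ?w = "inverse (?g z) * z * ((1 + z) / (1 - z) ^ 3)"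
    have "starlike_quotient koebe q = slice_point I (Re ?w) (Im ?w)"
      using False unfolding starlike_quotient_def
      by (simp only: if_False q koebe_slice_point[OF I] deriv[OF I z] slice_point_inverse[OF I] slice_point_mult[OF I])
    then have "qRe (starlike_quotient koebe q) = Re ?w"
      using quat_units_components(1)[OF I] by (simp add: slice_point_def)
    \<comment> \<open>Here d stands for 1 - z and u for 1 + z; kept atomic, the powers of d
      cancel.\<close>
    moreover have "inverse (z / d\<^sup>2) * z * (u / d ^ 3) = u / d" if "d \<noteq> 0" for d u
      using that z0 by (simp add: field_simps power2_eq_square power3_eq_cube)
    from this[OF z0(2), of "1 + z"] have "?w = (1 + z) / (1 - z)" .
    moreover have "Re ((1 + z) / (1 - z)) = (1 - (cmod z)\<^sup>2) / (cmod (1 - z))\<^sup>2"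
      unfolding Re_divide cmod_power2 by (simp add: power2_eq_square algebra_simps)
    moreover have "\<dots> > 0"
      using z z0 by (intro divide_pos_pos) (auto simp: power_less_one_iff abs_square_less_1)
    ultimately show ?thesis
      by metis
  qed (simp add: starlike_quotient_def)
  \<comment> \<open>This only supplies some unit, on whose slice the derivative at 0 is
    computed.\<close>
  obtain I z where "I \<in> quat_units" "0 = slice_point I (Re z) (Im z)"
    by (rule quat_on_slice)
  then have "slice_deriv koebe 0 = 1"
    using deriv[of I 0] by (simp add: slice_point_def)
  moreover have "{q \<in> quat_ball. koebe q = 0} = {0}"
    by (auto simp: koebe_def)
  ultimately show ?thesis
    using reg quotient by (simp add: slice_starlike_def slice_class_S_def koebe_def)
qed

lemma koebe_expansion: "has_normalized_expansion koebe of_nat"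
  unfolding has_normalized_expansion_def
proof
  fix q :: quat assume q1: "q \<in> quat_ball"
  obtain I z where I: "I \<in> quat_units" and q: "q = slice_point I (Re z) (Im z)"
    by (rule quat_on_slice)
  have z: "cmod z < 1"
    using q1 norm_slice_point[OF I, of z] by (simp add: q)
  have "slice_point I (Re (of_nat n)) (Im (of_nat n)) = of_nat n" for n
    by (simp add: slice_point_def)
  then have terms: "q ^ k * of_nat k = slice_point I (Re (of_nat k * z ^ k)) (Im (of_nat k * z ^ k))" for k
    using slice_point_mult[OF I, of "z ^ k" "of_nat k"] by (simp add: q slice_point_power[OF I] mult.commute)
  have "koebe q - q = slice_point I (Re (z / (1 - z)\<^sup>2 - z)) (Im (z / (1 - z)\<^sup>2 - z))"
    by (simp only: q koebe_slice_point[OF I]) (simp add: slice_point_def algebra_simps)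
  then show "(\<lambda>k. q ^ (k + 2) * of_nat (k + 2)) sums (koebe q - q)"
    using bounded_linear.sums[OF bounded_linear_slice_point sums_geometric_deriv_from_2[OF z]]
    by (simp only: terms)
qed

text \<open>At a real point q = r the sum is r/(1 - r)^2, which exceeds 1 between the two roots (3 -
  sqrt 5)/2 and (3 + sqrt 5)/2 of (1 - r)^2 = r.\<close>

lemma koebe_sharp:
  assumes "R > (3 - sqrt 5) / 2"
  shows "\<exists>q\<in>quat_ball. norm q \<le> R \<and>
    summable (\<lambda>k. norm (q ^ (k + 2) * of_nat (k + 2))) \<and>
    norm q + (\<Sum>k. norm (q ^ (k + 2) * of_nat (k + 2))) > 1"
proof -
  \<comment> \<open>The cap 1/2 keeps r in the unit ball and below the larger root, yet above the
    smaller one.\<close>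
  define r where "r = min R (1/2)"
  have s5: "2 < sqrt 5" "sqrt 5 < 3"
    by (auto intro: real_less_rsqrt real_less_lsqrt)
  then have r: "(3 - sqrt 5) / 2 < r" "r \<le> 1/2" "0 < r" "r \<le> R"
    using assms by (auto simp: r_def)
  have "(\<lambda>k. real (k + 2) * r ^ (k + 2)) sums (r / (1 - r)\<^sup>2 - r)"
    using r by (intro sums_geometric_deriv_from_2) auto
  moreover have "norm ((of_real r :: quat) ^ (k + 2) * of_nat (k + 2)) = real (k + 2) * r ^ (k + 2)" for k
    using r by (simp only: norm_mult norm_power norm_of_real norm_of_nat) simp
  ultimately have "(\<lambda>k. norm ((of_real r :: quat) ^ (k + 2) * of_nat (k + 2))) sums (r / (1 - r)\<^sup>2 - r)"
    by presburger
  moreover have "r / (1 - r)\<^sup>2 > 1"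
  proof -
    have "(r - (3 - sqrt 5) / 2) * (r - (3 + sqrt 5) / 2) < 0"
      using r s5 by (intro mult_pos_neg) auto
    moreover have "(r - (3 - sqrt 5) / 2) * (r - (3 + sqrt 5) / 2) = (1 - r)\<^sup>2 - r"
      by (simp add: field_simps power2_eq_square)
    ultimately have "(1 - r)\<^sup>2 < r"
      by simp
    then show ?thesis
      using r by simp
  qed
  ultimately show ?thesis
    using r by (intro bexI[of _ "of_real r"]) (auto simp: sums_iff)
qed

section \<open>Power series on the unit disc\<close>

lemma Cauchy_coefficient_has_integral:
  assumes holo: "f holomorphic_on ball 0 1" and r: "0 < r" "r < 1"
  shows "((\<lambda>t. f (of_real r * exp (2 * of_real pi * \<i> * of_real t))
      / (of_real r * exp (2 * of_real pi * \<i> * of_real t)) ^ n)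
    has_integral (deriv ^^ n) f 0 / fact n) {0..1}"
proof -
  let ?g = "\<lambda>t. of_real r * exp (2 * of_real pi * \<i> * of_real t)"
  have "continuous_on (cball 0 r) f" "f holomorphic_on ball 0 r"
    using holo r by (auto intro!: holomorphic_on_imp_continuous_on elim!: holomorphic_on_subset)
  then have "((\<lambda>u. f u / (u - 0) ^ Suc n) has_contour_integral
      (2 * pi * \<i>) / fact n * (deriv ^^ n) f 0) (circlepath 0 r)"
    using r by (intro Cauchy_has_contour_integral_higher_derivative_circlepath) auto
  then have "((\<lambda>t. f (?g t) / ?g t ^ Suc n * (2 * of_real pi * \<i> * ?g t)) has_integral
      (2 * pi * \<i>) / fact n * (deriv ^^ n) f 0) {0..1}"
    unfolding has_contour_integral vector_derivative_circlepath unfolding circlepath by simp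
  \<comment> \<open>The derivative of the circle path is 2 pi i times the point itself: this lowers
    the exponent from n + 1 to n and leaves 2 pi i to be divided out.\<close>
  from has_integral_mult_left[OF this, of "1 / (2 * pi * \<i>)"]
  show ?thesis
    by (rule has_integral_eq_rhs[OF has_integral_eq, rotated]) (use r in \<open>simp_all add: field_simps\<close>)
qed

text \<open>For n > 0 the n-th Fourier coefficient of f on a circle is also that of 2 Re f, since
  the conjugate of f contributes nothing. As Re f is nonnegative with mean 1, the triangle
  inequality gives 2.\<close>

lemma Caratheodory_coefficient_bound:
  fixes F :: "complex fps"
  assumes rad: "fps_conv_radius F \<ge> 1" and F0: "fps_nth F 0 = 1"
    and pos: "\<And>z. cmod z < 1 \<Longrightarrow> Re (eval_fps F z) \<ge> 0"
    and n: "n > 0"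
  shows "cmod (fps_nth F n) \<le> 2"
proof -
  define f where "f = eval_fps F"
  have holo: "f holomorphic_on ball 0 1"
    unfolding f_def using rad by (intro holomorphic_on_eval_fps ball_eball_mono) (simp add: one_ereal_def)
  have coeff: "(deriv ^^ k) f 0 / fact k = fps_nth F k" for k
    unfolding f_def by (rule fps_nth_conv_deriv[symmetric]) (use rad in \<open>auto intro: less_le_trans[of _ 1]\<close>)
  have bound: "cmod (fps_nth F n) * r ^ n \<le> 2" if r: "0 < r" "r < 1" for r
  proof -
    define e where "e t = exp (2 * of_real pi * \<i> * of_real t)" for t :: real
    have ne: "cmod (e t) = 1" for t
      by (simp add: e_def)
    have ce: "cnj (e t) = inverse (e t)" for t
      by (simp add: e_def exp_cnj exp_minus[symmetric] del: exp_minus)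
    have I: "((\<lambda>t. f (r * e t) / (r * e t) ^ n) has_integral fps_nth F n) {0..1}"
      using Cauchy_coefficient_has_integral[OF holo r, of n] by (simp add: coeff e_def)
    have J: "((\<lambda>t. f (r * e t)) has_integral 1) {0..1}"
      using Cauchy_coefficient_has_integral[OF holo r, of 0] coeff[of 0] F0 by (simp add: e_def)
    \<comment> \<open>This function vanishes at 0, so its circle mean is zero; its conjugate
      supplies the second half of 2 Re f.\<close>
    have "(\<lambda>z. f z * z ^ n) holomorphic_on ball 0 1"
      by (intro holomorphic_intros holo)
    from Cauchy_coefficient_has_integral[OF this r, of 0]
    have K: "((\<lambda>t. f (r * e t) * (r * e t) ^ n) has_integral 0) {0..1}"
      using n by (simp add: e_def zero_power)
    have "((\<lambda>t. cnj (f (r * e t) * (r * e t) ^ n)) has_integral 0) {0..1}"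
      using has_integral_cnj[of "\<lambda>t. f (r * e t) * (r * e t) ^ n" 0] K
      by (simp add: o_def del: complex_cnj_mult complex_cnj_power)
    \<comment> \<open>The factor r^(2n) turns division by (r e)^n into multiplication by r^n e^(-n),
      as in the conjugated integrand.\<close>
    from has_integral_add[OF has_integral_mult_left[OF I, of "of_real (r ^ (2 * n))"] this]
    have "((\<lambda>t. of_real (2 * Re (f (r * e t)) * r ^ n) * inverse (e t) ^ n)
        has_integral fps_nth F n * of_real (r ^ (2 * n))) {0..1}"
    proof (rule has_integral_eq_rhs[OF has_integral_eq, rotated])
      fix t assume "t \<in> {0..1::real}"
      have "f (r * e t) / (r * e t) ^ n * of_real (r ^ (2 * n)) = f (r * e t) * r ^ n * inverse (e t) ^ n"
        using r ne[of t] by (simp add: field_simps power_mult_distrib power_mult power2_eq_square)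
      moreover have "cnj (f (r * e t) * (r * e t) ^ n) = cnj (f (r * e t)) * r ^ n * inverse (e t) ^ n"
        by (simp add: power_mult_distrib ce)
      moreover have two_Re: "of_real 2 * of_real (Re x) = x + cnj x" for x
        by (simp add: complex_add_cnj)
      ultimately show "f (r * e t) / (r * e t) ^ n * of_real (r ^ (2 * n)) + cnj (f (r * e t) * (r * e t) ^ n)
          = of_real (2 * Re (f (r * e t)) * r ^ n) * inverse (e t) ^ n"
        by (simp only: of_real_mult of_real_power) (simp only: two_Re distrib_right)
    qed simp
    note L = this
    have M: "((\<lambda>t. 2 * Re (f (r * e t)) * r ^ n) has_integral 2 * r ^ n) {0..1}"
      using has_integral_mult_left[OF has_integral_Re[OF J], of "2 * r ^ n"] by (simp add: mult_ac)
    have "cmod (fps_nth F n * of_real (r ^ (2 * n))) \<le> 2 * r ^ n"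
      unfolding integral_unique[OF L, symmetric] integral_unique[OF M, symmetric]
    proof (rule integral_norm_bound_integral[OF has_integral_integrable[OF L] has_integral_integrable[OF M]])
      fix t assume "t \<in> {0..1::real}"
      have "0 \<le> Re (f (r * e t))"
        unfolding f_def using r ne[of t] by (intro pos) (simp add: norm_mult)
      then show "cmod (of_real (2 * Re (f (r * e t)) * r ^ n) * inverse (e t) ^ n) \<le> 2 * Re (f (r * e t)) * r ^ n"
        using r ne[of t] by (simp add: norm_mult norm_power norm_inverse)
    qed
    then have "r ^ n * (cmod (fps_nth F n) * r ^ n) \<le> r ^ n * 2"
      using r by (simp add: norm_mult norm_power power_mult power2_eq_square mult_ac power_mult_distrib)
    then show ?thesis
      using r by simp
  qed
  \<comment> \<open>Letting r tend to 1 removes the factor r^n.\<close>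
  have "((\<lambda>r. cmod (fps_nth F n) * r ^ n) \<longlongrightarrow> cmod (fps_nth F n) * 1 ^ n) (at_left 1)"
    by (intro tendsto_intros)
  moreover have "\<forall>\<^sub>F r in at_left 1. cmod (fps_nth F n) * r ^ n \<le> 2"
    using bound by (intro eventually_at_leftI[of 0]) auto
  ultimately show ?thesis
    by (intro tendsto_upperbound[where F = "at_left (1::real)"]) auto
qed

text \<open>The series of cnj(F(cnj z)), which stays holomorphic where the pointwise conjugate would
  not. It enters because moving j past a coefficient conjugates the coefficient but not z.\<close>

definition fps_cnj :: "complex fps \<Rightarrow> complex fps" where
  "fps_cnj F = Abs_fps (\<lambda>n. cnj (fps_nth F n))"

lemma fps_cnj_nth [simp]: "fps_nth (fps_cnj F) n = cnj (fps_nth F n)"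
  by (simp add: fps_cnj_def)

lemma fps_cnj_simps [simp]:
  "fps_cnj (fps_cnj F) = F" "fps_cnj 1 = 1" "fps_cnj (F + G) = fps_cnj F + fps_cnj G"
  "fps_cnj (F - G) = fps_cnj F - fps_cnj G" "fps_cnj (F * G) = fps_cnj F * fps_cnj G"
  "fps_cnj fps_X = fps_X" "fps_cnj (fps_deriv F) = fps_deriv (fps_cnj F)"
  by (simp_all add: fps_eq_iff fps_mult_nth fps_X_def)

lemma fps_cnj_inverse:
  assumes "fps_nth F 0 \<noteq> 0"
  shows "fps_cnj (inverse F) = inverse (fps_cnj F)"
proof -
  have "fps_cnj F * fps_cnj (inverse F) = fps_cnj (F * inverse F)"
    by simp
  also have "\<dots> = 1"
    using assms by (subst inverse_mult_eq_1') simp_all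
  finally show ?thesis
    by (rule fps_inverse_unique[symmetric])
qed

lemma fps_conv_radius_cnj [simp]: "fps_conv_radius (fps_cnj F) = fps_conv_radius F"
  unfolding fps_conv_radius_def conv_radius_def by simp

context
  fixes F G :: "complex fps"
  assumes rad: "fps_conv_radius F \<ge> 1" "fps_conv_radius G \<ge> 1"
begin

lemma eval_fps_unit_disc:
  assumes "cmod z < 1"
  shows "eval_fps (F + G) z = eval_fps F z + eval_fps G z"
    "eval_fps (F - G) z = eval_fps F z - eval_fps G z"
    "eval_fps (F * G) z = eval_fps F z * eval_fps G z"
proof -
  have "ereal (cmod z) < 1"
    using assms by simp
  then have "ereal (cmod z) < fps_conv_radius F" "ereal (cmod z) < fps_conv_radius G"
    using rad less_le_trans by blast+
  then show "eval_fps (F + G) z = eval_fps F z + eval_fps G z"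
    "eval_fps (F - G) z = eval_fps F z - eval_fps G z"
    "eval_fps (F * G) z = eval_fps F z * eval_fps G z"
    by (simp_all add: eval_fps_add eval_fps_diff eval_fps_mult)
qed

end

lemma fps_conv_radius_deriv_ge:
  fixes F :: "complex fps"
  shows "r \<le> fps_conv_radius F \<Longrightarrow> r \<le> fps_conv_radius (fps_deriv F)"
  using fps_conv_radius_deriv[of F] by (rule order_trans[rotated])

lemma sums_eval_fps_unit_disc:
  fixes F :: "complex fps"
  assumes "fps_conv_radius F \<ge> 1" "cmod z < 1"
  shows "(\<lambda>n. z ^ n * fps_nth F n) sums eval_fps F z"
  using sums_eval_fps[of z F] assms less_le_trans[of "ereal (cmod z)" 1]
  by (simp add: mult.commute)

section \<open>Coefficients of starlike functions\<close>

text \<open>Convergence on the positive real axis suffices: there the powers are real scalars and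
  pass through the real-linear map.\<close>

lemma quat_conv_radius_ge:
  fixes \<phi> :: "quat \<Rightarrow> complex"
  assumes lin: "bounded_linear \<phi>"
    and summable: "\<And>r::real. 0 < r \<Longrightarrow> r < 1 \<Longrightarrow> summable (\<lambda>k. of_real r ^ k * p k)"
  shows "conv_radius (\<lambda>n. \<phi> (p n)) \<ge> 1"
proof (rule conv_radius_geI_ex)
  fix r :: real assume r: "0 < r" "ereal r < 1"
  have "\<phi> (of_real r ^ k * p k) = \<phi> (p k) * of_real r ^ k" for k
  proof -
    have "of_real r ^ k * p k = r ^ k *\<^sub>R p k"
      by (simp only: scaleR_conv_of_real of_real_power)
    then show ?thesis
      by (simp only: linear_cmul[OF bounded_linear.linear[OF lin]])
        (simp add: scaleR_conv_of_real mult.commute)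
  qed
  then have "summable (\<lambda>k. \<phi> (p k) * of_real r ^ k)"
    using bounded_linear.summable[OF lin summable[of r]] r by simp
  then show "\<exists>z. norm z = r \<and> summable (\<lambda>n. \<phi> (p n) * z ^ n)"
    using r by (intro exI[of _ "of_real r"]) simp
qed

lemma fps_X_mult_deriv_nth:
  fixes F :: "'a :: comm_ring_1 fps"
  shows "fps_nth (fps_X * fps_deriv F) k = of_nat k * fps_nth F k"
  by (cases k) simp_all

text \<open>In the intended case the sums \<open>a\<close> and \<open>b\<close> are f(q) and q
  f'(q). The inner product has the sign of the real part of \<open>inverse a * b\<close>, and its
  positivity forces \<open>a\<close> to be nonzero.\<close>

definition starlike_coeffs :: "(nat \<Rightarrow> quat) \<Rightarrow> bool" where
  "starlike_coeffs p \<longleftrightarrow> p 0 = 0 \<and> p 1 = 1 \<and>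
     (\<forall>q. norm q < 1 \<longrightarrow> q \<noteq> 0 \<longrightarrow> (\<exists>a b. (\<lambda>k. q ^ k * p k) sums a \<and>
       (\<lambda>k. real k *\<^sub>R (q ^ k * p k)) sums b \<and> inner a b > 0))"

text \<open>
  The coefficients \<open>h\<close> of the slice product quotient \<open>f\<^sup>-\<^sup>* * qf'\<close>: coefficientwise, \<open>f * h = qf'\<close>.
\<close>
definition log_deriv_coeffs :: "(nat \<Rightarrow> quat) \<Rightarrow> (nat \<Rightarrow> quat) \<Rightarrow> bool" where
  "log_deriv_coeffs p h \<longleftrightarrow>
     (\<forall>n. real (Suc n) *\<^sub>R p (Suc n) = (\<Sum>i\<le>n. p (Suc i) * h (n - i)))"

text \<open>The conjugated coefficients belong to w^-1 f(w q w^-1) w, and conjugation by w preserves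
  inner products.\<close>

lemma starlike_coeffs_conjugate:
  assumes p: "starlike_coeffs p" and w: "w \<noteq> 0"
  shows "starlike_coeffs (\<lambda>k. inverse w * p k * w)"
  unfolding starlike_coeffs_def
proof (intro conjI allI impI)
  fix q :: quat assume q: "norm q < 1" "q \<noteq> 0"
  let ?q = "w * q * inverse w"
  have "norm ?q < 1" "?q \<noteq> 0"
    using q w by (auto simp: norm_conjugate)
  then obtain a b where ab: "(\<lambda>k. ?q ^ k * p k) sums a" "(\<lambda>k. real k *\<^sub>R (?q ^ k * p k)) sums b" "inner a b > 0"
    using p unfolding starlike_coeffs_def by blast
  have *: "inverse w * (?q ^ k * p k) * w = q ^ k * (inverse w * p k * w)" for k
  proof -
    have "inverse w * (?q ^ k * p k) * w = (inverse w * w) * q ^ k * (inverse w * p k * w)"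
      by (simp only: conjugate_power[OF w]) (simp only: mult.assoc)
    then show ?thesis
      using w by simp
  qed
  have "(\<lambda>k. q ^ k * (inverse w * p k * w)) sums (inverse w * a * w)"
    using sums_mult2[OF sums_mult[OF ab(1)], of "inverse w" w] by (simp only: *)
  moreover have "(\<lambda>k. real k *\<^sub>R (q ^ k * (inverse w * p k * w))) sums (inverse w * b * w)"
    using sums_mult2[OF sums_mult[OF ab(2)], of "inverse w" w]
    by (simp only: mult_scaleR_right mult_scaleR_left *)
  moreover have "inner (inverse w * a * w) (inverse w * b * w) > 0"
    using ab(3) w by (simp add: inner_quat_mult_left inner_quat_mult_right)
  ultimately show "\<exists>a b. (\<lambda>k. q ^ k * (inverse w * p k * w)) sums a \<and>
      (\<lambda>k. real k *\<^sub>R (q ^ k * (inverse w * p k * w))) sums b \<and> inner a b > 0"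
    by blast
qed (use p w in \<open>simp_all add: starlike_coeffs_def\<close>)

lemma log_deriv_coeffs_conjugate:
  assumes h: "log_deriv_coeffs p h" and w: "w \<noteq> 0"
  shows "log_deriv_coeffs (\<lambda>k. inverse w * p k * w) (\<lambda>k. inverse w * h k * w)"
  unfolding log_deriv_coeffs_def
proof
  fix n
  have *: "inverse w * (x * y) * w = (inverse w * x * w) * (inverse w * y * w)" for x y
  proof -
    have "w * (inverse w * z) = z" for z
      using w by (simp flip: mult.assoc)
    then show ?thesis
      by (simp only: mult.assoc)
  qed
  have "real (Suc n) *\<^sub>R (inverse w * p (Suc n) * w) = inverse w * (real (Suc n) *\<^sub>R p (Suc n)) * w"
    by simp
  also have "\<dots> = inverse w * (\<Sum>i\<le>n. p (Suc i) * h (n - i)) * w"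
    using h unfolding log_deriv_coeffs_def by metis
  also have "\<dots> = (\<Sum>i\<le>n. (inverse w * p (Suc i) * w) * (inverse w * h (n - i) * w))"
    by (simp only: sum_distrib_left sum_distrib_right *)
  finally show "real (Suc n) *\<^sub>R (inverse w * p (Suc n) * w)
      = (\<Sum>i\<le>n. (inverse w * p (Suc i) * w) * (inverse w * h (n - i) * w))" .
qed

text \<open>As \<open>p 1 = 1\<close>, the term i = 0 of the recursion is \<open>h n\<close> itself,
  so the earlier values of \<open>h\<close> determine it.\<close>

lemma log_deriv_coeffs_unique:
  assumes "p 1 = 1" "log_deriv_coeffs p h" "log_deriv_coeffs p h'"
  shows "h n = h' n"
proof (induction n rule: less_induct)
  case (less n)
  have "real (Suc n) *\<^sub>R p (Suc n) = g n + (\<Sum>i<n. p (Suc (Suc i)) * g (n - Suc i))"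
    if "log_deriv_coeffs p g" for g
    using that \<open>p 1 = 1\<close> unfolding log_deriv_coeffs_def by (simp add: sum.atMost_shift)
  then have "h n + (\<Sum>i<n. p (Suc (Suc i)) * h (n - Suc i))
      = h' n + (\<Sum>i<n. p (Suc (Suc i)) * h' (n - Suc i))"
    using assms(2,3) by metis
  moreover have "(\<Sum>i<n. p (Suc (Suc i)) * h (n - Suc i)) = (\<Sum>i<n. p (Suc (Suc i)) * h' (n - Suc i))"
    by (intro sum.cong) (use less in simp_all)
  ultimately show ?case
    by simp
qed

section \<open>The matrix of power series attached to starlike coefficients\<close>

locale starlike_series =
  fixes p :: "nat \<Rightarrow> quat"
  assumes starlike: "starlike_coeffs p"
begin

text \<open>The index is shifted by one because \<open>p 0 = 0\<close>: \<open>a\<close> and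
  \<open>b\<close> are the coordinates of f/z, with constant terms 1 and 0, while \<open>A'\<close>
  and \<open>B'\<close> are those of f'.\<close>

definition a :: "complex fps" where "a = Abs_fps (\<lambda>n. quat_fst (p (Suc n)))"
definition b :: "complex fps" where "b = Abs_fps (\<lambda>n. quat_snd (p (Suc n)))"
definition A' :: "complex fps" where "A' = fps_deriv (fps_X * a)"
definition B' :: "complex fps" where "B' = fps_deriv (fps_X * b)"
text \<open>
  Up to powers of \<open>z\<close>, the stem function of \<open>f\<close> is the matrix with rows \<open>(a, b)\<close> and \<open>(-b\<^sup>c, a\<^sup>c)\<close>, where \<open>\<^sup>c\<close>
  conjugates coefficients; \<open>\<delta>\<close> is its determinant and \<open>(C, D)\<close> the first row of its inverse times
  the derivative.
\<close>
definition \<delta> :: "complex fps" where "\<delta> = a * fps_cnj a + b * fps_cnj b"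
definition C :: "complex fps" where "C = (fps_cnj a * A' + b * fps_cnj B') * inverse \<delta>"
definition D :: "complex fps" where "D = (fps_cnj a * B' - b * fps_cnj A') * inverse \<delta>"

lemma p_0: "p 0 = 0" and p_1: "p (Suc 0) = 1"
  using starlike by (auto simp: starlike_coeffs_def)

lemma fps_nth_simps [simp]:
  "fps_nth a n = quat_fst (p (Suc n))" "fps_nth b n = quat_snd (p (Suc n))"
  "fps_nth A' n = of_nat (Suc n) * quat_fst (p (Suc n))"
  "fps_nth B' n = of_nat (Suc n) * quat_snd (p (Suc n))"
  by (simp_all add: a_def b_def A'_def B'_def algebra_simps)

lemma \<delta>_0: "fps_nth \<delta> 0 = 1"
  by (simp add: \<delta>_def p_1)

lemma conv_radius_ge [simp]: "fps_conv_radius a \<ge> 1" "fps_conv_radius b \<ge> 1"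
proof -
  have *: "summable (\<lambda>k. of_real r ^ k * p k)" if "0 < r" "r < 1" for r :: real
  proof -
    have "norm (of_real r :: quat) < 1" "(of_real r :: quat) \<noteq> 0"
      using that by auto
    then show ?thesis
      using starlike unfolding starlike_coeffs_def summable_def by blast
  qed
  have "conv_radius (\<lambda>n. \<phi> (p (Suc n))) \<ge> 1" if "bounded_linear \<phi>" for \<phi> :: "quat \<Rightarrow> complex"
    using quat_conv_radius_ge[OF that *] conv_radius_shift[of "\<lambda>n. \<phi> (p n)" 1] by simp
  then show "fps_conv_radius a \<ge> 1" "fps_conv_radius b \<ge> 1"
    unfolding fps_conv_radius_def
    by (simp_all add: a_def b_def bounded_linear_quat_fst bounded_linear_quat_snd)
qed

lemma conv_radius_ge' [simp]:
  "fps_conv_radius A' \<ge> 1" "fps_conv_radius B' \<ge> 1" "fps_conv_radius \<delta> \<ge> 1"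
  unfolding A'_def B'_def \<delta>_def
  by (intro fps_conv_radius_deriv_ge fps_conv_radius_mult_ge fps_conv_radius_add_ge; simp)+

text \<open>
  The starlikeness condition at \<open>q = c\<^sup>-\<^sup>1zc\<close> with \<open>c = s + tj\<close>: there
  \<open>c q\<^sup>k p\<^sub>k = z\<^sup>k c p\<^sub>k\<close>, so that \<open>c f(q)\<close> has complex coordinates that are holomorphic in \<open>z\<close>.
\<close>
lemma positivity:
  assumes z: "cmod z < 1" "z \<noteq> 0" and st: "s \<noteq> 0 \<or> t \<noteq> 0"
  shows "Re (cnj (s * eval_fps a z - t * eval_fps (fps_cnj b) z) *
        (s * eval_fps A' z - t * eval_fps (fps_cnj B') z) +
      cnj (s * eval_fps b z + t * eval_fps (fps_cnj a) z) *
        (s * eval_fps B' z + t * eval_fps (fps_cnj A') z)) > 0" (is "Re (cnj ?X * ?U + cnj ?Y * ?V) > 0")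
proof -
  define c where "c = quat_pair s t"
  have c: "c \<noteq> 0"
    using st by (auto simp: c_def quat_eq_fst_snd)
  let ?q = "inverse c * quat_of_complex z * inverse (inverse c)"
  have "norm ?q = cmod z"
    using norm_conjugate[of "inverse c" "quat_of_complex z"] c by simp
  with z have "norm ?q < 1" "?q \<noteq> 0"
    by auto
  then obtain x y where xy: "(\<lambda>k. ?q ^ k * p k) sums x" "(\<lambda>k. real k *\<^sub>R (?q ^ k * p k)) sums y"
      "inner x y > 0"
    using starlike unfolding starlike_coeffs_def by blast
  have *: "c * (?q ^ k * p k) = quat_of_complex (z ^ k) * (c * p k)" for k
  proof -
    have "c * (?q ^ k * p k) = (c * inverse c) * quat_of_complex z ^ k * (c * p k)"
      by (simp only: conjugate_power[OF nonzero_imp_inverse_nonzero[OF c]]) (simp only: mult.assoc inverse_inverse_eq)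
    then show ?thesis
      using c by (simp add: quat_of_complex_power)
  qed
  \<comment> \<open>These are the coordinates of (s + tj)(x + yj) = (s x - t cnj(y)) + (s y + t
    cnj(x)) j, applied to each \<open>p k\<close>; \<open>fps_X\<close> undoes the index
    shift.\<close>
  define F where "F = fps_const s * (fps_X * a) - fps_const t * (fps_X * fps_cnj b)"
  define G where "G = fps_const s * (fps_X * b) + fps_const t * (fps_X * fps_cnj a)"
  have F: "fps_nth F k = quat_fst (c * p k)" and G: "fps_nth G k = quat_snd (c * p k)" for k
    by (cases k, simp_all add: F_def G_def c_def p_0)
  have rad: "fps_conv_radius F \<ge> 1" "fps_conv_radius G \<ge> 1"
    unfolding F_def G_def
    by (intro fps_conv_radius_diff_ge fps_conv_radius_add_ge fps_conv_radius_mult_ge; simp)+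
  have rad': "fps_conv_radius (fps_X * fps_deriv F) \<ge> 1" "fps_conv_radius (fps_X * fps_deriv G) \<ge> 1"
    by (intro fps_conv_radius_mult_ge fps_conv_radius_deriv_ge rad; simp)+
  have cx: "(\<lambda>k. quat_of_complex (z ^ k) * (c * p k)) sums (c * x)"
    using sums_mult[OF xy(1), of c] by (simp only: *)
  have cy: "(\<lambda>k. real k *\<^sub>R (quat_of_complex (z ^ k) * (c * p k))) sums (c * y)"
    using sums_mult[OF xy(2), of c] by (simp only: * mult_scaleR_right)
  have x1: "quat_fst (c * x) = eval_fps F z"
    using bounded_linear.sums[OF bounded_linear_quat_fst cx] sums_eval_fps_unit_disc[OF rad(1) z(1)]
    by (intro sums_unique2) (simp_all add: F)
  have x2: "quat_snd (c * x) = eval_fps G z"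
    using bounded_linear.sums[OF bounded_linear_quat_snd cx] sums_eval_fps_unit_disc[OF rad(2) z(1)]
    by (intro sums_unique2) (simp_all add: G)
  have y1: "quat_fst (c * y) = eval_fps (fps_X * fps_deriv F) z"
    using bounded_linear.sums[OF bounded_linear_quat_fst cy] sums_eval_fps_unit_disc[OF rad'(1) z(1)]
    by (intro sums_unique2) (simp_all add: F fps_X_mult_deriv_nth scaleR_conv_of_real mult_ac del: fps_X_mult_nth fps_deriv_nth)
  have y2: "quat_snd (c * y) = eval_fps (fps_X * fps_deriv G) z"
    using bounded_linear.sums[OF bounded_linear_quat_snd cy] sums_eval_fps_unit_disc[OF rad'(2) z(1)]
    by (intro sums_unique2) (simp_all add: G fps_X_mult_deriv_nth scaleR_conv_of_real mult_ac del: fps_X_mult_nth fps_deriv_nth)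
  have F': "fps_deriv F = fps_const s * A' - fps_const t * fps_cnj B'"
    and G': "fps_deriv G = fps_const s * B' + fps_const t * fps_cnj A'"
    by (simp_all add: F_def G_def A'_def B'_def)
  note rules = fps_conv_radius_diff_ge fps_conv_radius_add_ge fps_conv_radius_mult_ge
  have evals: "eval_fps F z = z * ?X" "eval_fps G z = z * ?Y"
    "eval_fps (fps_X * fps_deriv F) z = z * ?U" "eval_fps (fps_X * fps_deriv G) z = z * ?V"
    unfolding F' G' unfolding F_def G_def using z(1)
    by (simp_all add: eval_fps_unit_disc rules algebra_simps)
  have Re_of_real_mult: "Re (of_real r * u) = r * Re u" for r u
    by simp
  have "0 < (norm c)\<^sup>2 * inner x y"
    using c xy(3) by simp
  also have "\<dots> = Re (cnj (z * ?X) * (z * ?U) + cnj (z * ?Y) * (z * ?V))"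
    unfolding inner_quat_mult_left[symmetric] inner_quat_fst_snd[of "c * x"] x1 x2 y1 y2 evals ..
  \<comment> \<open>All four coordinates carry a factor z; together these give |z|^2 > 0, which is
    then cancelled.\<close>
  also have "cnj (z * ?X) * (z * ?U) + cnj (z * ?Y) * (z * ?V)
      = of_real ((cmod z)\<^sup>2) * (cnj ?X * ?U + cnj ?Y * ?V)"
    unfolding complex_norm_square by (simp add: algebra_simps)
  also have "Re \<dots> = (cmod z)\<^sup>2 * Re (cnj ?X * ?U + cnj ?Y * ?V)"
    by (rule Re_of_real_mult)
  finally show ?thesis
    using z(2) by (simp only: zero_less_mult_iff) auto
qed

lemma eval_\<delta>: "cmod z < 1 \<Longrightarrow> eval_fps \<delta> z =
    eval_fps a z * eval_fps (fps_cnj a) z + eval_fps b z * eval_fps (fps_cnj b) z"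
  unfolding \<delta>_def by (simp add: eval_fps_unit_disc fps_conv_radius_mult_ge)

text \<open>If the determinant vanished at z, some nonzero row vector (s, t) would annihilate the
  matrix from the left. Then both coordinates of c f(q) vanish, against
  \<open>positivity\<close>.\<close>

lemma \<delta>_nonzero:
  assumes z: "cmod z < 1"
  shows "eval_fps \<delta> z \<noteq> 0"
proof (cases "z = 0")
  case True
  then show ?thesis
    by (simp add: eval_fps_at_0 \<delta>_0)
next
  case False
  show ?thesis
  proof
    assume "eval_fps \<delta> z = 0"
    then have 0: "eval_fps a z * eval_fps (fps_cnj a) z + eval_fps b z * eval_fps (fps_cnj b) z = 0"
      by (simp add: eval_\<delta> z)
    note pos = positivity[OF z False]
    \<comment> \<open>Candidates for (s, t) are the rows of the adjugate, and (1, 0) if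
      \<open>a\<close> and \<open>b\<close> both vanish at z.\<close>
    consider "eval_fps (fps_cnj b) z \<noteq> 0 \<or> eval_fps a z \<noteq> 0"
      | "eval_fps (fps_cnj a) z \<noteq> 0 \<or> - eval_fps b z \<noteq> 0"
      | "eval_fps a z = 0" "eval_fps b z = 0"
      by auto
    then show False
    proof cases
      case 1
      from pos[OF this] 0 show False
        by (simp add: algebra_simps)
    next
      case 2
      from pos[OF this] 0 show False
        by (simp add: algebra_simps)
    next
      case 3
      with pos[of 1 0] show False
        by simp
    qed
  qed
qed

lemma conv_radius_inverse_\<delta>: "fps_conv_radius (inverse \<delta>) \<ge> 1"
  and eval_inverse_\<delta>: "cmod z < 1 \<Longrightarrow> eval_fps (inverse \<delta>) z = inverse (eval_fps \<delta> z)"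
proof -
  have *: "\<And>z. z \<in> eball 0 1 \<Longrightarrow> eval_fps \<delta> z \<noteq> 0"
    by (intro \<delta>_nonzero) simp
  have "min 1 (fps_conv_radius \<delta>) \<le> fps_conv_radius (inverse \<delta>)"
    by (rule fps_conv_radius_inverse) (rule *, simp)
  then show "fps_conv_radius (inverse \<delta>) \<ge> 1"
    using conv_radius_ge'(3) by (simp add: min_def split: if_splits)
  show "eval_fps (inverse \<delta>) z = inverse (eval_fps \<delta> z)" if "cmod z < 1"
    by (rule eval_fps_inverse[where r = 1])
      (use * that conv_radius_ge'(3) in \<open>auto intro: less_le_trans[of _ 1]\<close>)
qed

lemma C_conv_radius: "fps_conv_radius C \<ge> 1"
  unfolding C_def
  by (intro fps_conv_radius_mult_ge fps_conv_radius_add_ge conv_radius_inverse_\<delta>; simp)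

lemma C_0: "fps_nth C 0 = 1"
  using \<delta>_0 by (simp add: C_def p_1)

text \<open>Take (s, t) to be the first row of the adjugate. The coordinates of c f(q), divided by
  z, become (\<delta>, 0), and \<open>positivity\<close> reads Re(cnj(\<delta>) U) > 0 with C = U /
  \<delta>.\<close>

lemma C_positive:
  assumes z: "cmod z < 1"
  shows "Re (eval_fps C z) > 0"
proof (cases "z = 0")
  case True
  then show ?thesis
    by (simp add: eval_fps_at_0 C_0)
next
  case False
  let ?s = "eval_fps (fps_cnj a) z" and ?t = "- eval_fps b z" and ?d = "eval_fps \<delta> z"
  define U where "U = ?s * eval_fps A' z - ?t * eval_fps (fps_cnj B') z"
  have d: "?d = eval_fps a z * ?s + eval_fps b z * eval_fps (fps_cnj b) z"
    using eval_\<delta>[OF z] .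
  then have st: "?s \<noteq> 0 \<or> ?t \<noteq> 0"
    using \<delta>_nonzero[OF z] by auto
  have "Re (cnj ?d * U) > 0"
    using positivity[OF z False st] by (simp add: d U_def mult_ac)
  moreover have "eval_fps C z = U / ?d"
    unfolding C_def using z
    by (simp add: eval_fps_unit_disc fps_conv_radius_mult_ge fps_conv_radius_add_ge
        conv_radius_inverse_\<delta> eval_inverse_\<delta> U_def divide_inverse)
  moreover have "Re (U / ?d) = Re (cnj ?d * U) / (cmod ?d)\<^sup>2"
    by (simp add: Re_divide cmod_power2 add_divide_distrib mult_ac)
  ultimately show ?thesis
    using \<delta>_nonzero[OF z] by simp
qed

text \<open>These are the two complex coordinates of \<open>f * h = qf'\<close>, divided by \<open>q\<close>.\<close>
lemma quotient_relations: "a * C - b * fps_cnj D = A'" "a * D + b * fps_cnj C = B'"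
proof -
  have i: "\<delta> * inverse \<delta> = 1"
    using \<delta>_0 by (intro inverse_mult_eq_1') simp
  have "fps_cnj (inverse \<delta>) = inverse \<delta>"
    using \<delta>_0 by (subst fps_cnj_inverse) (simp_all add: \<delta>_def mult_ac)
  then have cnj: "fps_cnj C = (a * fps_cnj A' + fps_cnj b * B') * inverse \<delta>"
      "fps_cnj D = (a * fps_cnj B' - fps_cnj b * A') * inverse \<delta>"
    by (simp_all add: C_def D_def)
  have "a * C - b * fps_cnj D = A' * (\<delta> * inverse \<delta>)"
    unfolding cnj unfolding C_def \<delta>_def[THEN arg_cong, of "\<lambda>x. A' * (x * inverse \<delta>)"]
    by (simp add: algebra_simps)
  then show "a * C - b * fps_cnj D = A'"
    by (simp add: i)
  have "a * D + b * fps_cnj C = B' * (\<delta> * inverse \<delta>)"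
    unfolding cnj unfolding D_def \<delta>_def[THEN arg_cong, of "\<lambda>x. B' * (x * inverse \<delta>)"]
    by (simp add: algebra_simps)
  then show "a * D + b * fps_cnj C = B'"
    by (simp add: i)
qed

text \<open>Caratheodory's inequality is applied to C alone, so the bound reaches just the first
  complex coordinate of h.\<close>

lemma log_deriv_coeffs_exists:
  obtains h where "log_deriv_coeffs p h" "\<And>n. n > 0 \<Longrightarrow> cmod (quat_fst (h n)) \<le> 2"
proof
  let ?h = "\<lambda>n. quat_pair (fps_nth C n) (fps_nth D n)"
  show "cmod (quat_fst (?h n)) \<le> 2" if "n > 0" for n
    using Caratheodory_coefficient_bound[OF C_conv_radius C_0 _ that] C_positive
    by (simp add: order_less_imp_le)
  show "log_deriv_coeffs p ?h"
    unfolding log_deriv_coeffs_def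
  proof
    fix n
    have "fps_nth (a * C - b * fps_cnj D) n = fps_nth A' n"
      "fps_nth (a * D + b * fps_cnj C) n = fps_nth B' n"
      by (simp_all only: quotient_relations)
    then show "real (Suc n) *\<^sub>R p (Suc n) = (\<Sum>i\<le>n. p (Suc i) * ?h (n - i))"
      by (simp add: quat_eq_fst_snd fps_mult_nth atLeast0AtMost scaleR_conv_of_real sum_subtractf sum.distrib)
  qed
qed

end

text \<open>
  Starlikeness is invariant under \<open>p\<^sub>k \<mapsto> w\<^sup>-\<^sup>1p\<^sub>kw\<close>, so \<open>h\<^sub>n\<close> may be assumed to lie in \<open>\<complex>\<close>, where its first
  complex coordinate is all of it.
\<close>
lemma log_deriv_coeffs_bound:
  assumes p: "starlike_coeffs p" and h: "log_deriv_coeffs p h" and n: "n > 0"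
  shows "norm (h n) \<le> 2"
proof -
  obtain w z where w: "w \<noteq> 0" and hn: "h n = w * quat_of_complex z * inverse w"
    by (rule quat_conjugate_into_complex)
  let ?p = "\<lambda>k. inverse w * p k * w"
  have p': "starlike_coeffs ?p"
    using p w by (rule starlike_coeffs_conjugate)
  then interpret starlike_series ?p
    by unfold_locales
  obtain h' where h': "log_deriv_coeffs ?p h'" "\<And>n. n > 0 \<Longrightarrow> cmod (quat_fst (h' n)) \<le> 2"
    using log_deriv_coeffs_exists by blast
  \<comment> \<open>The conjugated h solves the recursion of the conjugated p, so uniqueness
    identifies it with the bounded solution.\<close>
  have "h' n = inverse w * h n * w"
    using p_1 by (intro log_deriv_coeffs_unique[OF _ h'(1) log_deriv_coeffs_conjugate[OF h w]]) simp
  also have "\<dots> = (inverse w * w) * quat_of_complex z * (inverse w * w)"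
    unfolding hn by (simp only: mult.assoc)
  also have "\<dots> = quat_of_complex z"
    using w by simp
  finally show ?thesis
    using h'(2)[OF n] by (simp only: hn norm_conjugate[OF w] norm_quat_of_complex quat_fst_pair)
qed

lemma starlike_coeffs_bound:
  assumes p: "starlike_coeffs p"
  shows "norm (p n) \<le> real n"
proof -
  interpret starlike_series p
    using p by unfold_locales
  obtain h where h: "log_deriv_coeffs p h"
    by (rule log_deriv_coeffs_exists)
  have h0: "h 0 = 1"
    using h[unfolded log_deriv_coeffs_def, rule_format, of 0] p_1 by simp
  show ?thesis
  proof (induction n rule: less_induct)
    case (less n)
    show ?case
    proof (cases "n \<le> 1")
      case True
      then consider "n = 0" | "n = Suc 0" by linarith
      then show ?thesis
        by cases (simp_all add: p_0 p_1)
    next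
      case False
      then obtain m where m: "n = Suc m" "m > 0"
        by (cases n) auto
      \<comment> \<open>The term i = m equals \<open>p (Suc m)\<close> because
        \<open>h 0 = 1\<close>; moving it to the left leaves the factor m = n - 1.\<close>
      have "real (Suc m) *\<^sub>R p (Suc m) = (\<Sum>i<m. p (Suc i) * h (m - i)) + p (Suc m)"
        using h h0 unfolding log_deriv_coeffs_def by (simp flip: lessThan_Suc_atMost)
      then have "real m *\<^sub>R p n = (\<Sum>i<m. p (Suc i) * h (m - i))"
        by (simp add: m algebra_simps)
      then have "real m * norm (p n) = norm (\<Sum>i<m. p (Suc i) * h (m - i))"
        by (metis abs_of_nat norm_scaleR)
      also have "\<dots> \<le> (\<Sum>i<m. real (Suc i) * 2)"
      proof (rule sum_norm_le)
        fix i assume "i \<in> {..<m}"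
        then have "norm (p (Suc i)) \<le> real (Suc i)" "norm (h (m - i)) \<le> 2"
          using less.IH[of "Suc i"] log_deriv_coeffs_bound[OF p h] m by auto
        then show "norm (p (Suc i) * h (m - i)) \<le> real (Suc i) * 2"
          unfolding norm_mult by (intro mult_mono) auto
      qed
      \<comment> \<open>2(1 + ... + m) = m(m + 1) = m n.\<close>
      also have "\<dots> = real m * real n"
        unfolding m(1) by (induction m) (simp_all add: algebra_simps)
      finally show ?thesis
        using m by simp
    qed
  qed
qed

section \<open>From slice derivatives to power series coefficients\<close>

lemma slice_deriv_eq_slice_dx:
  assumes f: "slice_regular f" and I: "I \<in> quat_units" and B: "slice_point I x y \<in> quat_ball"
  shows "slice_deriv f (slice_point I x y) = slice_dx I f x y"
proof -
  have "(x, y) \<in> slice_ball I"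
    using B by (simp add: slice_ball_def)
  then have "(1/2) *\<^sub>R (slice_dx I f x y + I * slice_dy I f x y) = 0"
    using f I unfolding slice_regular_def by fast
  \<comment> \<open>By Cauchy-Riemann the two halves of the slice derivative agree, so it equals the
    x-derivative.\<close>
  then have "I * slice_dy I f x y = - slice_dx I f x y"
    by (simp add: eq_neg_iff_add_eq_0 add.commute)
  then show ?thesis
    using slice_deriv_slice_point[OF f I B] by (simp flip: scaleR_2)
qed

text \<open>For q = w z w^-1 one has q^k p_k = w z^k (w^-1 p_k). With w pulled out to the left, f on
  the slice is w times a pair of complex power series in z, which can be differentiated termwise
  along x.\<close>

lemma slice_deriv_power_series:
  assumes f: "slice_regular f"
    and sums: "\<And>q. norm q < 1 \<Longrightarrow> (\<lambda>k. q ^ k * p k) sums f q"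
    and q: "norm q < 1"
  shows "(\<lambda>k. real k *\<^sub>R (q ^ k * p k)) sums (q * slice_deriv f q)"
proof -
  obtain w z where w: "w \<noteq> 0" and qw: "q = w * quat_of_complex z * inverse w"
    by (rule quat_conjugate_into_complex)
  have z: "cmod z < 1"
    using q norm_conjugate[OF w] by (simp add: qw)
  define I where "I = w * quat_of_complex \<i> * inverse w"
  have I: "I \<in> quat_units"
    unfolding I_def by (rule conjugate_unit[OF w])
  have slice: "slice_point I (Re u) (Im u) = w * quat_of_complex u * inverse w" for u
    unfolding I_def by (rule slice_point_conjugate[OF w, symmetric])
  have pow: "(w * quat_of_complex u * inverse w) ^ k * p k = w * (quat_of_complex (u ^ k) * (inverse w * p k))" for u k
    by (simp only: conjugate_power[OF w] quat_of_complex_power) (simp only: mult.assoc)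
  define F where "F = Abs_fps (\<lambda>k. quat_fst (inverse w * p k))"
  define G where "G = Abs_fps (\<lambda>k. quat_snd (inverse w * p k))"
  have summable: "summable (\<lambda>k. of_real r ^ k * p k)" if "0 < r" "r < 1" for r :: real
    by (rule sums_summable[OF sums]) (use that in simp)
  have "conv_radius (\<lambda>n. quat_fst (inverse w * p n)) \<ge> 1" "conv_radius (\<lambda>n. quat_snd (inverse w * p n)) \<ge> 1"
    by (rule quat_conv_radius_ge[OF _ summable],
      rule bounded_linear_compose[OF _ bounded_linear_mult_right],
      rule bounded_linear_quat_fst bounded_linear_quat_snd, assumption+)+
  then have rad: "fps_conv_radius F \<ge> 1" "fps_conv_radius G \<ge> 1"
    by (simp_all add: F_def G_def fps_conv_radius_def)
  have coords: "quat_of_complex u * (inverse w * p k) = quat_pair (u * fps_nth F k) (u * fps_nth G k)" for u k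
    by (simp add: quat_eq_fst_snd F_def G_def)
  have f_eq: "f (slice_point I (Re u) (Im u)) = w * quat_pair (eval_fps F u) (eval_fps G u)" if "cmod u < 1" for u
  proof -
    have "norm (slice_point I (Re u) (Im u)) < 1"
      using that norm_slice_point[OF I] by simp
    from sums[OF this] have "(\<lambda>k. w * quat_pair (u ^ k * fps_nth F k) (u ^ k * fps_nth G k)) sums f (slice_point I (Re u) (Im u))"
      by (simp only: slice pow coords)
    moreover have "(\<lambda>k. w * quat_pair (u ^ k * fps_nth F k) (u ^ k * fps_nth G k)) sums (w * quat_pair (eval_fps F u) (eval_fps G u))"
      by (intro sums_mult sums_quat_pair sums_eval_fps_unit_disc rad that)
    ultimately show ?thesis
      by (rule sums_unique2)
  qed
  have "((\<lambda>t. Complex t (Im z)) has_vector_derivative 1) (at (Re z))"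
    unfolding Complex_eq by (auto intro!: derivative_eq_intros)
  from field_vector_diff_chain_at[OF this]
  have chain: "((\<lambda>t. eval_fps H (Complex t (Im z))) has_vector_derivative eval_fps (fps_deriv H) z) (at (Re z))"
    if "fps_conv_radius H \<ge> 1" for H
    using has_field_derivative_eval_fps[of z H UNIV] z that less_le_trans[of "ereal (cmod z)" 1]
    by (force simp: o_def)
  have "((\<lambda>t. w * quat_pair (eval_fps F (Complex t (Im z))) (eval_fps G (Complex t (Im z))))
      has_vector_derivative w * quat_pair (eval_fps (fps_deriv F) z) (eval_fps (fps_deriv G) z)) (at (Re z))"
    by (intro bounded_linear.has_vector_derivative[OF bounded_linear_mult_right]
        has_vector_derivative_quat_pair chain rad)
  moreover have "open {t. cmod (Complex t (Im z)) < 1}"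
    unfolding Complex_eq by (intro open_Collect_less continuous_intros)
  ultimately have "((\<lambda>t. f (slice_point I t (Im z)))
      has_vector_derivative w * quat_pair (eval_fps (fps_deriv F) z) (eval_fps (fps_deriv G) z)) (at (Re z))"
    by (rule has_vector_derivative_transform_within_open) (use z f_eq[of "Complex _ (Im z)"] in auto)
  then have "slice_dx I f (Re z) (Im z) = w * quat_pair (eval_fps (fps_deriv F) z) (eval_fps (fps_deriv G) z)"
    unfolding slice_dx_def by (rule vector_derivative_at)
  then have "slice_deriv f q = w * quat_pair (eval_fps (fps_deriv F) z) (eval_fps (fps_deriv G) z)"
    using slice_deriv_eq_slice_dx[OF f I, of "Re z" "Im z"] q by (simp add: slice qw)
  then have "q * slice_deriv f q = w * quat_of_complex z * (inverse w * w) *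
      quat_pair (eval_fps (fps_deriv F) z) (eval_fps (fps_deriv G) z)"
    by (simp only: qw mult.assoc)
  also have "\<dots> = w * (quat_of_complex z * quat_pair (eval_fps (fps_deriv F) z) (eval_fps (fps_deriv G) z))"
    using w by (simp add: mult.assoc)
  also have "quat_of_complex z * quat_pair (eval_fps (fps_deriv F) z) (eval_fps (fps_deriv G) z)
      = quat_pair (eval_fps (fps_X * fps_deriv F) z) (eval_fps (fps_X * fps_deriv G) z)"
    using z by (simp add: quat_eq_fst_snd eval_fps_unit_disc fps_conv_radius_deriv_ge rad)
  finally have lim: "q * slice_deriv f q
      = w * quat_pair (eval_fps (fps_X * fps_deriv F) z) (eval_fps (fps_X * fps_deriv G) z)" .
  have "(\<lambda>k. w * quat_pair (z ^ k * fps_nth (fps_X * fps_deriv F) k) (z ^ k * fps_nth (fps_X * fps_deriv G) k))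
      sums (q * slice_deriv f q)"
    unfolding lim
    by (intro sums_mult sums_quat_pair sums_eval_fps_unit_disc fps_conv_radius_mult_ge
        fps_conv_radius_deriv_ge rad z) simp_all
  moreover have "w * quat_pair (z ^ k * fps_nth (fps_X * fps_deriv F) k) (z ^ k * fps_nth (fps_X * fps_deriv G) k)
      = real k *\<^sub>R (q ^ k * p k)" for k
  proof -
    have "quat_pair (z ^ k * fps_nth (fps_X * fps_deriv F) k) (z ^ k * fps_nth (fps_X * fps_deriv G) k)
        = real k *\<^sub>R quat_pair (z ^ k * fps_nth F k) (z ^ k * fps_nth G k)"
      unfolding fps_X_mult_deriv_nth by (simp add: quat_eq_fst_snd scaleR_conv_of_real)
    then show ?thesis
      by (simp only: qw pow coords mult_scaleR_right)
  qed
  ultimately show ?thesis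
    by simp
qed

lemma slice_starlike_coeffs:
  assumes f: "f \<in> slice_starlike" and p: "has_normalized_expansion f p"
  shows "starlike_coeffs (\<lambda>k. if k = 0 then 0 else if k = 1 then 1 else p k)" (is "starlike_coeffs ?p")
  unfolding starlike_coeffs_def
proof (intro conjI allI impI)
  \<comment> \<open>The values 0 and 1 at the first two indices make the full series sum to f(q)
    instead of f(q) - q.\<close>
  have sums: "(\<lambda>k. q ^ k * ?p k) sums f q" if "norm q < 1" for q
  proof -
    have "(\<lambda>k. q ^ (k + 2) * ?p (k + 2)) sums (f q - q)"
      using p that by (simp add: has_normalized_expansion_def)
    then have "(\<lambda>k. q ^ k * ?p k) sums (f q - q + (\<Sum>k<2. q ^ k * ?p k))"
      by (rule sums_iff_shift[of "\<lambda>k. q ^ k * ?p k" 2, THEN iffD1])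
    then show ?thesis
      by (simp add: numeral_2_eq_2)
  qed
  fix q :: quat assume q: "norm q < 1" "q \<noteq> 0"
  have reg: "slice_regular f" and pos: "qRe (starlike_quotient f q) > 0"
    using f q by (auto simp: slice_starlike_def slice_class_S_def)
  from pos q(2) have "inner (f q) (q * slice_deriv f q) / (norm (f q))\<^sup>2 > 0"
    by (simp only: starlike_quotient_def if_False mult.assoc qRe_inverse_mult)
  \<comment> \<open>Division by zero yields 0, so positivity of the quotient passes to its numerator
    without a separate case f(q) = 0.\<close>
  then have "inner (f q) (q * slice_deriv f q) > 0"
    by (simp add: zero_less_divide_iff)
  then show "\<exists>a b. (\<lambda>k. q ^ k * ?p k) sums a \<and>
       (\<lambda>k. real k *\<^sub>R (q ^ k * ?p k)) sums b \<and> inner a b > 0"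
    using sums[OF q(1)] slice_deriv_power_series[OF reg sums q(1)] by blast
qed simp_all

section \<open>The Bohr inequality for slice starlike functions\<close>

lemma slice_starlike_coeff_bound:
  assumes "f \<in> slice_starlike" "has_normalized_expansion f p"
  shows "norm (p (k + 2)) \<le> real (k + 2)"
  using starlike_coeffs_bound[OF slice_starlike_coeffs[OF assms], of "k + 2"] by simp

lemma slice_starlike_series_bound:
  assumes f: "f \<in> slice_starlike" "has_normalized_expansion f p"
    and q: "norm q \<le> (3 - sqrt 5) / 2"
  shows "summable (\<lambda>k. norm (q ^ (k + 2) * p (k + 2)))"
    and "norm q + (\<Sum>k. norm (q ^ (k + 2) * p (k + 2))) \<le> 1"
proof -
  define r where "r = norm q"
  have s5: "2 < sqrt 5" "sqrt 5 < 3"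
    by (auto intro: real_less_rsqrt real_less_lsqrt)
  then have r: "0 \<le> r" "r \<le> (3 - sqrt 5) / 2" "r < 1/2"
    using q by (auto simp: r_def)
  have le: "norm (q ^ (k + 2) * p (k + 2)) \<le> real (k + 2) * r ^ (k + 2)" for k
    using mult_left_mono[OF slice_starlike_coeff_bound[OF f, of k], of "r ^ (k + 2)"] r(1)
    by (simp only: norm_mult norm_power r_def mult.commute zero_le_power)
  have s: "(\<lambda>k. real (k + 2) * r ^ (k + 2)) sums (r / (1 - r)\<^sup>2 - r)"
    using r by (intro sums_geometric_deriv_from_2) auto
  show summable: "summable (\<lambda>k. norm (q ^ (k + 2) * p (k + 2)))"
    by (rule summable_comparison_test'[OF sums_summable[OF s], of 0]) (simp only: real_norm_def abs_norm_cancel le)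
  \<comment> \<open>r lies at or below both roots of (1 - r)^2 - r, so this polynomial is
    nonnegative at r.\<close>
  have "(r - (3 - sqrt 5) / 2) * (r - (3 + sqrt 5) / 2) \<ge> 0"
    using r s5 by (intro mult_nonpos_nonpos) auto
  moreover have "(r - (3 - sqrt 5) / 2) * (r - (3 + sqrt 5) / 2) = (1 - r)\<^sup>2 - r"
    by (simp add: field_simps power2_eq_square)
  ultimately have "r / (1 - r)\<^sup>2 \<le> 1"
    using r by simp
  moreover have "(\<Sum>k. norm (q ^ (k + 2) * p (k + 2))) \<le> r / (1 - r)\<^sup>2 - r"
    using suminf_le[OF le summable sums_summable[OF s]] sums_unique[OF s] by metis
  ultimately show "norm q + (\<Sum>k. norm (q ^ (k + 2) * p (k + 2))) \<le> 1"
    by (simp add: r_def)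
qed

theorem theorem1p1:
  shows "(\<forall>f\<in>slice_starlike. \<forall>p. has_normalized_expansion f p \<longrightarrow>
            (\<forall>q\<in>quat_ball. norm q \<le> (3 - sqrt 5) / 2 \<longrightarrow>
               summable (\<lambda>k. norm (q ^ (k + 2) * p (k + 2))) \<and>
               norm q + (\<Sum>k. norm (q ^ (k + 2) * p (k + 2))) \<le> 1))
       \<and> (\<forall>R > (3 - sqrt 5) / 2. \<exists>f\<in>slice_starlike. \<exists>p. has_normalized_expansion f p \<and>
            (\<exists>q\<in>quat_ball. norm q \<le> R \<and>
               summable (\<lambda>k. norm (q ^ (k + 2) * p (k + 2))) \<and>
               norm q + (\<Sum>k. norm (q ^ (k + 2) * p (k + 2))) > 1))"
proof (intro conjI allI impI)
  show "\<forall>f\<in>slice_starlike. \<forall>p. has_normalized_expansion f p \<longrightarrow>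
      (\<forall>q\<in>quat_ball. norm q \<le> (3 - sqrt 5) / 2 \<longrightarrow>
         summable (\<lambda>k. norm (q ^ (k + 2) * p (k + 2))) \<and>
         norm q + (\<Sum>k. norm (q ^ (k + 2) * p (k + 2))) \<le> 1)"
    by (intro ballI allI impI conjI slice_starlike_series_bound)
next
  fix R :: real assume R: "R > (3 - sqrt 5) / 2"
  show "\<exists>f\<in>slice_starlike. \<exists>p. has_normalized_expansion f p \<and>
      (\<exists>q\<in>quat_ball. norm q \<le> R \<and>
         summable (\<lambda>k. norm (q ^ (k + 2) * p (k + 2))) \<and>
         norm q + (\<Sum>k. norm (q ^ (k + 2) * p (k + 2))) > 1)"
    by (rule bexI[OF _ koebe_slice_starlike], rule exI[of _ of_nat],
        rule conjI[OF koebe_expansion koebe_sharp[OF R]])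
qed

end
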